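(* Let $\bar F$ be the complementary CDF of the equilibrium workload distribution (in the mean field limit $N\to\infty$, i.e. of the equilibrium cavity queue) of the distributed storage system described in the context. For $k\ge 1$, $j\ge 1$ and $w \geq 0$ define $$H_{j,k}(w)=\sum_{m=1}^{j}\min\{m,k\}\binom{j}{m}\bar F(w)^{j-m}(1-\bar F(w))^{m}-1 .$$ Then $\bar F$ satisfies the integro-differential equation, for $w>0$, $$\bar F'(w)=-\sum_{i\in\{h,c\}}\lambda p_i\sum_{j=1}^{d_i}B_j(d_i)\left[\bar G_i(w)+H_{j,\min\{j,k_i\}}(w)-\int_0^w H_{j,\min\{j,k_i\}}(u)\,g_i(w-u)\,du\right],$$ with boundary condition $\bar F(0)=\rho$, where $$\rho=\lambda p_h\,\mathbb{E}[\hat X_h]\,(1-B_0(d_h))+\lambda p_c\,\mathbb{E}[X_c]\sum_{m=1}^{d_c}\frac{\min\{m,k_c\}}{k_c}B_m(d_c),\qquad \mathbb{E}[X_c]=k_c\,\mathbb{E}[\hat X_c].$$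
   Context: System. There are $N$ servers, each a FIFO queue working at unit rate. File requests arrive as a Poisson process of rate $\lambda N$. Each request is independently of type $i\in\{h,c\}$ (hot or cold) with probability $p_i$, $p_h+p_c=1$. A type $i$ request selects $d_i$ distinct servers uniformly at random. The integers $d_i,k_i$ satisfy $1\le k_i\le d_i$, and $k_h=1$. Each selected server is available (not failed) with probability $q\in(0,1]$, independently. Put $B_j(d)=\binom{d}{j}q^j(1-q)^{d-j}$, the probability that exactly $j$ of $d$ selected servers are available. If exactly $j\ge1$ selected servers are available, the request is served on these by the policy LL$(j,\min\{j,k_i\})$: among the $j$ available servers, one fragment is served at each of the $\min\{j,k_i\}$ servers having smallest workload (ties broken uniformly at random), and nothing is served at the others. In particular, when $j<k_i$ all $j$ available servers still serve a fragment. All fragments of one request have the same service time, distributed as $\hat X_i$ and independent of everything else. The file service time is $X_i=k_i\hat X_i$. Service times. $\hat X_i=\delta_i+Y_i$ with $\delta_i\ge0$ constant and $Y_i$ phase-type PH$(\alpha_i,A_i)$, with density $\alpha_i e^{A_i w}\mu_i$, $\mu_i=-A_i\mathbf 1$. The CDF, complementary CDF and density of $\hat X_i$ are $G_i,\bar G_i,g_i$. Workload and equilibrium cavity queue. The workload of a server is the pending work that will actually be served there. In the limit $N\to\infty$, workloads of different servers are taken to be independent with a common law $F$ ($\bar F=1-F$), having an atom at $0$ and a density on $(0,\infty)$. $F$ is an equilibrium workload distribution if it is the stationary law of the following cavity queue. The workload $U$ decreases at unit rate while positive. For each $i$, potential arrivals of type $i$ (events that the queue is one of the $d_i$ selected servers)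 occur at Poisson rate $\lambda p_i d_i$. At a potential arrival, the cavity queue and the other $d_i-1$ selected servers are each independently available with probability $q$, and the other servers have i.i.d. workloads with law $F$, independent of $U$. If the cavity queue is available, $j$ denotes the total number of available selected servers (including it), and the cavity queue is among the $\min\{j,k_i\}$ least loaded of these, then $U$ jumps up by $\hat X_i$; otherwise $U$ is unchanged. *)

theory Defs
  imports "HOL-Probability.Probability"
begin

datatype ftype = Hot | Cold


section \<open>Service times\<close>

definition mat_exp :: "real^'n^'n \<Rightarrow> real^'n^'n" where
  "mat_exp A = (\<Sum>m. (1 / fact m) *\<^sub>R (((**) A ^^ m) (mat 1)))"

definition exit_rates :: "real^'n^'n \<Rightarrow> real^'n" where
  "exit_rates A = - (A *v (\<chi> i. 1))"

text \<open>The initial law puts no mass on the absorbing state, so that the law has no atom at 0;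
  invertibility of the subgenerator says that absorption is certain.\<close>

definition phase_type :: "real^'n \<Rightarrow> real^'n^'n \<Rightarrow> bool" where
  "phase_type \<alpha> A \<longleftrightarrow>
     (\<forall>i. 0 \<le> \<alpha> $ i) \<and> (\<Sum>i\<in>UNIV. \<alpha> $ i) = 1 \<and>
     (\<forall>i j. i \<noteq> j \<longrightarrow> 0 \<le> A $ i $ j) \<and> (\<forall>i. 0 \<le> exit_rates A $ i) \<and> invertible A"

definition ph_density :: "real^'n \<Rightarrow> real^'n^'n \<Rightarrow> real \<Rightarrow> real" where
  "ph_density \<alpha> A w = (if 0 \<le> w then (\<alpha> v* mat_exp (w *\<^sub>R A)) \<bullet> exit_rates A else 0)"

text \<open>Law and density of \<open>\<delta> + Y\<close> with \<open>Y\<close> of phase type.\<close>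

definition service_law :: "real \<Rightarrow> real^'n \<Rightarrow> real^'n^'n \<Rightarrow> real measure" where
  "service_law \<delta> \<alpha> A = distr (density lborel (\<lambda>y. ennreal (ph_density \<alpha> A y))) borel (\<lambda>y. \<delta> + y)"

definition service_density :: "real \<Rightarrow> real^'n \<Rightarrow> real^'n^'n \<Rightarrow> real \<Rightarrow> real" where
  "service_density \<delta> \<alpha> A x = ph_density \<alpha> A (x - \<delta>)"

definition ccdf :: "real measure \<Rightarrow> real \<Rightarrow> real" where
  "ccdf F w = measure F {w<..}"


section \<open>Poisson processes\<close>

text \<open>\<open>N t\<close> counts the points in \<open>(0, t]\<close>.  Rate 0 is allowed (almost surely no points).\<close>

definition poisson_process :: "'a measure \<Rightarrow> real \<Rightarrow> (real \<Rightarrow> 'a \<Rightarrow> nat) \<Rightarrow> bool" where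
  "poisson_process M r N \<longleftrightarrow>
     (\<forall>t\<ge>0. N t \<in> measurable M (count_space UNIV)) \<and>
     (AE \<omega> in M. N 0 \<omega> = 0 \<and> mono_on {0..} (\<lambda>t. N t \<omega>) \<and>
        (\<forall>t\<ge>0. continuous (at_right t) (\<lambda>s. N s \<omega>))) \<and>
     (\<forall>ts :: nat \<Rightarrow> real. 0 \<le> ts 0 \<and> mono ts \<longrightarrow>
        prob_space.indep_vars M (\<lambda>_. count_space UNIV)
          (\<lambda>m \<omega>. N (ts (Suc m)) \<omega> - N (ts m) \<omega>) UNIV) \<and>
     (\<forall>s t n. 0 \<le> s \<and> s \<le> t \<longrightarrow>
        measure M {\<omega> \<in> space M. N t \<omega> - N s \<omega> = n} =
          exp (- (r * (t - s))) * (r * (t - s)) ^ n / fact n)"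

text \<open>The points are numbered from 0: point number \<open>n\<close> of a counting path lies at \<open>t\<close>.\<close>

definition point_at :: "(real \<Rightarrow> nat) \<Rightarrow> nat \<Rightarrow> real \<Rightarrow> bool" where
  "point_at c n t \<longleftrightarrow> 0 < t \<and> n < c t \<and> (\<forall>s. 0 \<le> s \<and> s < t \<longrightarrow> c s \<le> n)"


section \<open>The cavity queue\<close>

text \<open>The servers of \<open>J\<close> that serve a fragment under LL(\<open>card J\<close>, \<open>min (card J) k\<close>).
  Ties in the workload are resolved by the priorities, which below are i.i.d. uniform on
  \<open>[0, 1]\<close>, hence almost surely distinct and in uniformly random order.\<close>

definition LL_served :: "nat set \<Rightarrow> nat \<Rightarrow> (nat \<Rightarrow> real) \<Rightarrow> (nat \<Rightarrow> real) \<Rightarrow> nat set" where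
  "LL_served J k load prio =
     {s \<in> J. card {r \<in> J. load r < load s \<or> (load r = load s \<and> prio r < prio s)}
               < min (card J) k}"

text \<open>
  The random input of a cavity queue on the probability space \<open>M\<close>.  The selected servers of a
  potential arrival of type \<open>i\<close> are numbered \<open>0, \<dots>, d i - 1\<close>; number 0 is the cavity queue itself.
  For the \<open>n\<close>-th potential arrival of type \<open>i\<close>, \<open>Av i n s\<close> is the availability and \<open>V i n s\<close> the
  tie-breaking priority of server \<open>s\<close>, \<open>W i n s\<close> the workload of server \<open>s \<noteq> 0\<close>, and \<open>S i n\<close> the
  service time of a fragment.
\<close>

datatype input =
  Initial | Arrivals ftype | Avail ftype nat nat | Load ftype nat nat | Prio ftype nat nat
  | Service ftype nat

definition inputs :: "(ftype \<Rightarrow> nat) \<Rightarrow> input set" where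
  "inputs d = {Initial} \<union> range Arrivals
     \<union> {Avail i n s | i n s. s < d i} \<union> {Load i n s | i n s. 0 < s \<and> s < d i}
     \<union> {Prio i n s | i n s. s < d i} \<union> {Service i n | i n. True}"

fun input_events ::
  "'a measure \<Rightarrow> ('a \<Rightarrow> real) \<Rightarrow> (ftype \<Rightarrow> real \<Rightarrow> 'a \<Rightarrow> nat) \<Rightarrow> (ftype \<Rightarrow> nat \<Rightarrow> nat \<Rightarrow> 'a \<Rightarrow> bool)
    \<Rightarrow> (ftype \<Rightarrow> nat \<Rightarrow> nat \<Rightarrow> 'a \<Rightarrow> real) \<Rightarrow> (ftype \<Rightarrow> nat \<Rightarrow> nat \<Rightarrow> 'a \<Rightarrow> real)
    \<Rightarrow> (ftype \<Rightarrow> nat \<Rightarrow> 'a \<Rightarrow> real) \<Rightarrow> input \<Rightarrow> 'a set set"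
where
  "input_events M U0 N Av W V S Initial = sets (vimage_algebra (space M) U0 borel)"
| "input_events M U0 N Av W V S (Arrivals i) =
     sigma_sets (space M) (\<Union>t\<in>{0..}. sets (vimage_algebra (space M) (N i t) (count_space UNIV)))"
| "input_events M U0 N Av W V S (Avail i n s) =
     sets (vimage_algebra (space M) (Av i n s) (count_space UNIV))"
| "input_events M U0 N Av W V S (Load i n s) = sets (vimage_algebra (space M) (W i n s) borel)"
| "input_events M U0 N Av W V S (Prio i n s) = sets (vimage_algebra (space M) (V i n s) borel)"
| "input_events M U0 N Av W V S (Service i n) = sets (vimage_algebra (space M) (S i n) borel)"

text \<open>\<open>U\<close> is the workload process, \<open>X i\<close> the law of a fragment's service time, and \<open>F\<close> the law of
  the workloads of the other servers.\<close>

definition cavity_queue ::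
  "'a measure \<Rightarrow> real \<Rightarrow> (ftype \<Rightarrow> real) \<Rightarrow> (ftype \<Rightarrow> nat) \<Rightarrow> (ftype \<Rightarrow> nat) \<Rightarrow> real
    \<Rightarrow> (ftype \<Rightarrow> real measure) \<Rightarrow> real measure
    \<Rightarrow> (ftype \<Rightarrow> real \<Rightarrow> 'a \<Rightarrow> nat) \<Rightarrow> (ftype \<Rightarrow> nat \<Rightarrow> nat \<Rightarrow> 'a \<Rightarrow> bool)
    \<Rightarrow> (ftype \<Rightarrow> nat \<Rightarrow> nat \<Rightarrow> 'a \<Rightarrow> real) \<Rightarrow> (ftype \<Rightarrow> nat \<Rightarrow> nat \<Rightarrow> 'a \<Rightarrow> real)
    \<Rightarrow> (ftype \<Rightarrow> nat \<Rightarrow> 'a \<Rightarrow> real) \<Rightarrow> (real \<Rightarrow> 'a \<Rightarrow> real) \<Rightarrow> bool"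
where
  "cavity_queue M lam p d k q X F N Av W V S U \<longleftrightarrow>
     prob_space M \<and>
     (\<forall>t\<ge>0. U t \<in> borel_measurable M) \<and>
     (\<forall>i. poisson_process M (lam * p i * real (d i)) (N i)) \<and>
     (\<forall>i n. \<forall>s<d i. Av i n s \<in> measurable M (count_space UNIV) \<and>
        distr M (count_space UNIV) (Av i n s) = measure_pmf (bernoulli_pmf q)) \<and>
     (\<forall>i n. \<forall>s\<in>{1..<d i}. W i n s \<in> borel_measurable M \<and> distr M borel (W i n s) = F) \<and>
     (\<forall>i n. \<forall>s<d i. V i n s \<in> borel_measurable M \<and>
        distr M borel (V i n s) = uniform_measure lborel {0..1}) \<and>
     (\<forall>i n. S i n \<in> borel_measurable M \<and> distr M borel (S i n) = X i) \<and>
     prob_space.indep_sets M (input_events M (U 0) N Av W V S) (inputs d) \<and>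
     (AE \<omega> in M.
        (\<forall>s t. 0 \<le> s \<and> s \<le> t \<and> (\<forall>i. N i s \<omega> = N i t \<omega>) \<longrightarrow>
           U t \<omega> = max 0 (U s \<omega> - (t - s))) \<and>
        (\<forall>i n t. point_at (\<lambda>s. N i s \<omega>) n t \<longrightarrow>
           (\<exists>u. ((\<lambda>s. U s \<omega>) \<longlongrightarrow> u) (at_left t) \<and>
              U t \<omega> = (if 0 \<in> LL_served {s. s < d i \<and> Av i n s \<omega>} (k i)
                                 (\<lambda>s. if s = 0 then u else W i n s \<omega>) (\<lambda>s. V i n s \<omega>)
                        then u + S i n \<omega> else u))))"

definition workload_law :: "real measure \<Rightarrow> bool" where
  "workload_law F \<longleftrightarrow>
     prob_space F \<and> sets F = sets borel \<and> measure F {..<0} = 0 \<and> 0 < measure F {0} \<and>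
     (\<exists>f \<in> borel_measurable borel. \<forall>A \<in> sets borel. A \<subseteq> {0<..} \<longrightarrow>
        emeasure F A = (\<integral>\<^sup>+ x \<in> A. ennreal (f x) \<partial>lborel))"

text \<open>\<open>F\<close> is stationary for the cavity queue whose other servers have workload law \<open>F\<close>;
  \<open>M\<close> is the probability space carrying the queue.\<close>

definition equilibrium_workload ::
  "'a measure \<Rightarrow> real \<Rightarrow> (ftype \<Rightarrow> real) \<Rightarrow> (ftype \<Rightarrow> nat) \<Rightarrow> (ftype \<Rightarrow> nat) \<Rightarrow> real
    \<Rightarrow> (ftype \<Rightarrow> real measure) \<Rightarrow> real measure \<Rightarrow> bool"
where
  "equilibrium_workload M lam p d k q X F \<longleftrightarrow>
     workload_law F \<and>
     (\<exists>N Av W V S U. cavity_queue M lam p d k q X F N Av W V S U \<and>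
        (\<forall>t\<ge>0. distr M borel (U t) = F))"


section \<open>Coefficients\<close>

definition B :: "real \<Rightarrow> nat \<Rightarrow> nat \<Rightarrow> real" where
  "B q j d = real (d choose j) * q ^ j * (1 - q) ^ (d - j)"

definition H :: "real measure \<Rightarrow> nat \<Rightarrow> nat \<Rightarrow> real \<Rightarrow> real" where
  "H F j k w =
     (\<Sum>m=1..j. real (min m k) * real (j choose m) * ccdf F w ^ (j - m) * (1 - ccdf F w) ^ m) - 1"

end

theory Submission
  imports Defs
begin

text \<open>
  The workload crosses a level \<open>w > 0\<close> downwards at rate \<open>- F'(w)\<close>, where \<open>F\<close> is the
  complementary distribution function, and upwards when a service time carries it from at most \<open>w\<close>
  to above \<open>w\<close>.  Conditioning on the arrivals in a window of length \<open>h\<close> and letting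
  \<open>h \<rightarrow> 0\<close> turns stationarity into the equality of both rates.  By exchangeability, \<open>d\<close> times the
  probability that the cavity queue is served and has workload at most \<open>u\<close> is the expected number
  of servers that are served and have workload at most \<open>u\<close>.  The servers of small workload go first,
  so this number is the minimum of \<open>k\<close> and the number of available servers with workload at most
  \<open>u\<close>, and its mean is a binomial sum.  Integrating the up-crossing rate over all levels gives the
  boundary value.
\<close>

section \<open>Phase-type densities\<close>

text \<open>Differentiability of \<open>ccdf F\<close> is derived: of \<open>F\<close> only a
  measurable density on the positive half-line is given, so both one-sided difference quotients are
  computed from stationarity. One estimate serves for both, since its level \<open>w'\<close> at the
  end of the window is free: \<open>w\<close> for the right quotient, \<open>w - h\<close> for the
  left one. The obstacle is the unknown instant of the arrival inside the window. Before it the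
  workload may have dropped by up to \<open>h\<close>, which could alter its rank among the selected
  servers. Away from 0 independent workloads almost surely differ, so the rank changes only with
  vanishing probability. At 0 ties have positive probability, but there the workload does not move
  and the same priorities decide. That the jump ends within \<open>h\<close> of the level also has
  vanishing probability. Stationarity enters a second time: it gives the cavity queue the workload
  law of the servers it competes with, without which the selected servers would not be
  exchangeable.\<close>

lemma matpow_bound:
  fixes A :: "real^'n^'n"
  assumes "\<And>i j. \<bar>A $ i $ j\<bar> \<le> b"
  shows "\<bar>(((**) A ^^ m) (mat 1)) $ i $ j\<bar> \<le> (real CARD('n) * b) ^ m"
proof (induction m arbitrary: i j)
  case 0
  then show ?case by (simp add: mat_def)
next
  case (Suc m)
  let ?P = "((**) A ^^ m) (mat 1)"
  have b: "0 \<le> b" using assms[of i i] abs_ge_zero order_trans by blast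
  have "\<bar>(A ** ?P) $ i $ j\<bar> \<le> (\<Sum>l\<in>UNIV. \<bar>A $ i $ l * ?P $ l $ j\<bar>)"
    by (simp add: matrix_matrix_mult_def)
  also have "\<dots> \<le> (\<Sum>l\<in>(UNIV::'n set). b * (real CARD('n) * b) ^ m)"
    unfolding abs_mult by (intro sum_mono mult_mono assms Suc.IH b) auto
  also have "\<dots> = (real CARD('n) * b) ^ Suc m" by simp
  finally show ?case by simp
qed

lemma summable_matpow:
  fixes A :: "real^'n^'n"
  shows "summable (\<lambda>m. \<bar>(((**) A ^^ m) (mat 1)) $ i $ j / fact m\<bar>)"
proof -
  define b where "b = Max (range (\<lambda>(i, j). \<bar>A $ i $ j\<bar>))"
  have "\<bar>A $ i $ j\<bar> \<le> b" for i j
    unfolding b_def by (rule Max_ge) (auto intro!: image_eqI[where x="(i,j)"])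
  then have "norm \<bar>(((**) A ^^ m) (mat 1)) $ i $ j / fact m\<bar>
      \<le> inverse (fact m) * (real CARD('n) * b) ^ m" for m
    using matpow_bound[of A b m i j] by (simp add: divide_simps)
  then show ?thesis
    by (intro summable_comparison_test'[OF summable_exp, where N=0]) blast
qed

text \<open>Convergence is coordinatewise, so every entry of the exponential is an absolutely
  convergent real series, open to Cauchy products and to measurability of series.\<close>

lemma mat_exp_nth:
  "mat_exp A $ i $ j = (\<Sum>m. (((**) A ^^ m) (mat 1)) $ i $ j / fact m)"
proof -
  let ?f = "\<lambda>m i j. (((**) A ^^ m) (mat 1)) $ i $ j / fact m"
  have "(\<lambda>m. (1 / fact m) *\<^sub>R (((**) A ^^ m) (mat 1))) sums (\<chi> i j. \<Sum>m. ?f m i j)"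
    unfolding sums_def
    by (intro vec_tendstoI)
       (use summable_LIMSEQ[OF summable_rabs_cancel[OF summable_matpow[of A]]] in simp)
  then show ?thesis by (simp add: mat_exp_def sums_unique[symmetric])
qed

lemma matpow_scaleR:
  fixes A :: "real^'n^'n"
  shows "((**) (t *\<^sub>R A) ^^ m) (mat 1) = t ^ m *\<^sub>R ((**) A ^^ m) (mat 1)"
  by (induction m)
     (simp_all add: vec_eq_iff matrix_matrix_mult_def sum_distrib_left mult_ac)

text \<open>The binomial theorem for \<open>A\<close> and a multiple of the identity, which commute.
  As for scalars, the induction step is an index shift followed by Pascal's rule.\<close>

lemma matpow_shift:
  fixes A :: "real^'n^'n"
  shows "(((**) (A + mat c) ^^ m) (mat 1)) $ i $ j
    = (\<Sum>l\<le>m. real (m choose l) * c ^ (m - l) * (((**) A ^^ l) (mat 1)) $ i $ j)"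
proof (induction m arbitrary: i j)
  case (Suc m)
  let ?P = "\<lambda>l. ((**) A ^^ l) (mat 1)"
  have mc: "(\<Sum>l\<in>UNIV. mat c $ i $ l * Q $ l $ j) = c * Q $ i $ j" for Q :: "real^'n^'n"
    by (simp add: mat_def if_distrib[where f="\<lambda>x. x * _"] cong: if_cong)
  have "(((**) (A + mat c) ^^ Suc m) (mat 1)) $ i $ j
      = (\<Sum>l\<le>m. real (m choose l) * c ^ (m - l) * ?P (Suc l) $ i $ j)
        + c * (\<Sum>l\<le>m. real (m choose l) * c ^ (m - l) * ?P l $ i $ j)"
    (is "_ = ?a + c * ?b")
  proof -
    have "(((**) (A + mat c) ^^ Suc m) (mat 1)) $ i $ j
        = (\<Sum>n\<in>UNIV. (A $ i $ n + mat c $ i $ n) * (((**) (A + mat c) ^^ m) (mat 1)) $ n $ j)"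
      by (simp add: matrix_matrix_mult_def)
    also have "\<dots> = (\<Sum>n\<in>UNIV. A $ i $ n * (((**) (A + mat c) ^^ m) (mat 1)) $ n $ j)
        + c * (((**) (A + mat c) ^^ m) (mat 1)) $ i $ j"
      by (simp add: distrib_right sum.distrib mc)
    also have "(\<Sum>n\<in>UNIV. A $ i $ n * (((**) (A + mat c) ^^ m) (mat 1)) $ n $ j) = ?a"
      unfolding Suc.IH sum_distrib_left
      by (subst sum.swap) (simp add: matrix_matrix_mult_def sum_distrib_left mult_ac)
    finally show ?thesis by (simp add: Suc.IH)
  qed
  also have "c * ?b = (\<Sum>l\<le>Suc m. real (m choose l) * c ^ (Suc m - l) * ?P l $ i $ j)"
    by (simp add: sum_distrib_left Suc_diff_le mult_ac)
  also have "\<dots> = c ^ Suc m * ?P 0 $ i $ j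
      + (\<Sum>l\<le>m. real (m choose Suc l) * c ^ (m - l) * ?P (Suc l) $ i $ j)"
    by (subst sum.atMost_Suc_shift) simp
  also have "?a + \<dots> = c ^ Suc m * ?P 0 $ i $ j
      + (\<Sum>l\<le>m. real (Suc m choose Suc l) * c ^ (m - l) * ?P (Suc l) $ i $ j)"
    by (simp add: sum.distrib[symmetric] algebra_simps)
  also have "\<dots> = (\<Sum>l\<le>Suc m. real (Suc m choose l) * c ^ (Suc m - l) * ?P l $ i $ j)"
    by (subst sum.atMost_Suc_shift) simp
  finally show ?case .
qed (simp add: mat_def)

text \<open>Adding a multiple of the identity makes all entries, hence all powers, nonnegative, and only
  multiplies the exponential by a positive scalar.\<close>

lemma mat_exp_nonneg:
  fixes A :: "real^'n^'n"
  assumes "\<And>i j. i \<noteq> j \<Longrightarrow> 0 \<le> A $ i $ j"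
  shows "0 \<le> mat_exp A $ i $ j"
proof -
  define c where "c = Max (range (\<lambda>i. \<bar>A $ i $ i\<bar>))"
  have c: "\<bar>A $ i $ i\<bar> \<le> c" for i
    unfolding c_def by (rule Max_ge) auto
  have C: "0 \<le> (A + mat c) $ i $ j" for i j
    using assms[of i j] c[of i] by (cases "i = j") (simp_all add: mat_def)
  have P: "0 \<le> (((**) (A + mat c) ^^ m) (mat 1)) $ i $ j" for m i j
  proof (induction m arbitrary: i j)
    case (Suc m)
    have "0 \<le> (\<Sum>l\<in>UNIV. (A + mat c) $ i $ l * (((**) (A + mat c) ^^ m) (mat 1)) $ l $ j)"
      by (intro sum_nonneg mult_nonneg_nonneg C Suc.IH)
    then have "0 \<le> ((A + mat c) ** ((**) (A + mat c) ^^ m) (mat 1)) $ i $ j"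
      by (simp only: matrix_matrix_mult_def vec_lambda_beta)
    then show ?case by (simp only: funpow.simps o_apply)
  qed (simp add: mat_def)
  have ex: "exp c = (\<Sum>m. c ^ m / fact m)"
    by (simp add: exp_def divide_inverse mult.commute)
  have sc: "summable (\<lambda>m. norm (c ^ m / fact m))"
    using summable_norm_exp[of c] by (simp add: divide_inverse mult.commute)
  \<comment> \<open>The product rule for the exponentials of \<open>A\<close> and
    \<open>mat c\<close>: the factorials turn the Cauchy product into the binomial sum of
    \<open>matpow_shift\<close>.\<close>
  have "mat_exp A $ i $ j * exp c = (\<Sum>m. \<Sum>l\<le>m. (((**) A ^^ l) (mat 1)) $ i $ j / fact l * (c ^ (m - l) / fact (m - l)))"
    unfolding mat_exp_nth ex using summable_matpow[of A i j] sc
    by (intro Cauchy_product) simp_all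
  also have "\<dots> = (\<Sum>m. (((**) (A + mat c) ^^ m) (mat 1)) $ i $ j / fact m)"
    unfolding matpow_shift sum_divide_distrib
    by (intro suminf_cong sum.cong refl) (simp add: binomial_fact)
  also have "\<dots> \<ge> 0"
    by (intro suminf_nonneg summable_rabs_cancel[OF summable_matpow] divide_nonneg_pos P) simp
  finally show ?thesis by (simp add: zero_le_mult_iff)
qed

lemma ph_density_nonneg:
  assumes "phase_type \<alpha> A"
  shows "0 \<le> ph_density \<alpha> A w"
proof (cases "0 \<le> w")
  case True
  have "0 \<le> mat_exp (w *\<^sub>R A) $ i $ j" for i j
    using assms True by (intro mat_exp_nonneg) (simp add: phase_type_def)
  then show ?thesis
    using assms True unfolding ph_density_def phase_type_def inner_vec_def vector_matrix_mult_def
    by (auto intro!: sum_nonneg mult_nonneg_nonneg)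
qed (simp add: ph_density_def)

lemma ph_density_measurable [measurable]: "ph_density \<alpha> A \<in> borel_measurable borel"
proof -
  \<comment> \<open>Pulling \<open>w\<close> out of the powers makes each entry a power series in
    \<open>w\<close>, that is, a series of measurable functions.\<close>
  have [measurable]: "(\<lambda>w. mat_exp (w *\<^sub>R A) $ i $ j) \<in> borel_measurable borel" for i j
    unfolding mat_exp_nth matpow_scaleR by simp measurable
  show ?thesis
    unfolding ph_density_def[abs_def] inner_vec_def vector_matrix_mult_def vec_lambda_beta inner_real_def
    by measurable
qed

text \<open>Lebesgue measure is translation invariant, so adding \<open>\<delta>\<close> merely
  shifts the density.\<close>

lemma service_law_density:
  "service_law \<delta> \<alpha> A = density lborel (\<lambda>x. ennreal (service_density \<delta> \<alpha> A x))"
proof -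
  have "density lborel (\<lambda>x. ennreal (service_density \<delta> \<alpha> A x))
      = density (distr lborel borel (\<lambda>y. \<delta> + y)) (\<lambda>x. ennreal (service_density \<delta> \<alpha> A x))"
    by (subst lborel_distr_plus) simp
  also have "\<dots> = distr (density lborel (\<lambda>y. ennreal (service_density \<delta> \<alpha> A (\<delta> + y)))) borel (\<lambda>y. \<delta> + y)"
    unfolding service_density_def by (subst density_distr) simp_all
  finally show ?thesis by (simp add: service_law_def service_density_def)
qed

section \<open>The policy LL\<close>

lemma LL_served_subset: "LL_served J k L V \<subseteq> J"
  by (auto simp: LL_served_def)

lemma LL_served_cong:
  assumes "\<And>s. s \<in> J \<Longrightarrow> L s = L' s" "\<And>s. s \<in> J \<Longrightarrow> V s = V' s"
  shows "LL_served J k L V = LL_served J k L' V'"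
proof -
  have "{r \<in> J. L r < L s \<or> L r = L s \<and> V r < V s} = {r \<in> J. L' r < L' s \<or> L' r = L' s \<and> V' r < V' s}"
    if "s \<in> J" for s
    using assms that by auto
  then show ?thesis by (auto simp: LL_served_def)
qed

text \<open>The policy sees servers only through their workloads and priorities, never through their
  numbers. This is the deterministic half of exchangeability.\<close>

lemma LL_served_image:
  assumes "inj_on f J" "s \<in> J"
  shows "f s \<in> LL_served (f ` J) k L V \<longleftrightarrow> s \<in> LL_served J k (L \<circ> f) (V \<circ> f)"
proof -
  have "{r \<in> f ` J. L r < L (f s) \<or> L r = L (f s) \<and> V r < V (f s)}
      = f ` {r \<in> J. L (f r) < L (f s) \<or> L (f r) = L (f s) \<and> V (f r) < V (f s)}"
    by auto
  moreover have "inj_on f {r \<in> J. L (f r) < L (f s) \<or> L (f r) = L (f s) \<and> V (f r) < V (f s)}"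
    using assms(1) by (rule inj_on_subset) auto
  ultimately show ?thesis
    using assms by (simp add: LL_served_def card_image)
qed

text \<open>The servers with workload at most \<open>u\<close> come first in the order of service.\<close>

lemma card_LL_served_le:
  assumes "finite J" and V: "inj_on V J"
  shows "card {s \<in> LL_served J k L V. L s \<le> u} = min (card {s \<in> J. L s \<le> u}) k"
proof -
  \<comment> \<open>\<open>R s\<close> is the set of servers ahead of \<open>s\<close>, so
    \<open>card (R s)\<close> is the rank of \<open>s\<close>, counted from 0.\<close>
  define R where "R = (\<lambda>s. {r \<in> J. L r < L s \<or> L r = L s \<and> V r < V s})"
  define A where "A = {s \<in> J. L s \<le> u}"
  have fin: "finite A" "finite (R s)" for s
    using assms(1) by (auto simp: A_def R_def)
  have RA: "R s \<subset> A" if "s \<in> A" for s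
    using that by (auto simp: A_def R_def)
  have sub: "R s \<subset> R t" if "s \<in> R t" for s t
    using that by (auto simp: R_def)
  have tri: "s \<in> R t \<or> t \<in> R s" if "s \<in> J" "t \<in> J" "s \<noteq> t" for s t
  proof -
    have "V s < V t \<or> V t < V s"
      using that inj_onD[OF V, of s t] by (cases "V s" "V t" rule: linorder_cases) auto
    then show ?thesis using that by (auto simp: R_def)
  qed
  have inj: "inj_on (\<lambda>s. card (R s)) A"
  proof (rule inj_onI)
    fix s t assume "s \<in> A" "t \<in> A" and eq: "card (R s) = card (R t)"
    then have "s \<in> J" "t \<in> J" by (auto simp: A_def)
    then show "s = t"
      using tri[of s t] psubset_card_mono[OF fin(2) sub[of s t]] psubset_card_mono[OF fin(2) sub[of t s]] eq
      by auto
  qed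
  \<comment> \<open>All servers ahead of a member of \<open>A\<close> lie in \<open>A\<close>, and
    ranks are distinct; hence the ranks of \<open>A\<close> are exactly the numbers below
    \<open>card A\<close>.\<close>
  have "(\<lambda>s. card (R s)) ` A \<subseteq> {..<card A}"
    using psubset_card_mono[OF fin(1) RA] by auto
  then have img: "(\<lambda>s. card (R s)) ` A = {..<card A}"
    using card_image[OF inj] by (intro card_subset_eq) auto
  have "card A \<le> card J"
    using assms(1) by (intro card_mono) (auto simp: A_def)
  have "card {s \<in> LL_served J k L V. L s \<le> u} = card {s \<in> A. card (R s) < min (card J) k}"
    by (rule arg_cong[where f = card]) (auto simp: LL_served_def A_def R_def)
  also have "\<dots> = card ((\<lambda>s. card (R s)) ` {s \<in> A. card (R s) < min (card J) k})"
    by (intro card_image[symmetric] inj_on_subset[OF inj]) auto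
  also have "(\<lambda>s. card (R s)) ` {s \<in> A. card (R s) < min (card J) k} = {..<card A} \<inter> {..<min (card J) k}"
    unfolding img[symmetric] by auto
  also have "\<dots> = {..<min (card A) k}"
    using \<open>card A \<le> card J\<close> by auto
  finally show ?thesis by (simp add: A_def)
qed

text \<open>Given the value of \<open>Y\<close>, a point that is no atom of \<open>X\<close> is hit
  with probability 0. The set \<open>A\<close> restricts this to values of \<open>Y\<close> where
  \<open>X\<close> has no atom; for workloads it has to exclude 0.\<close>

lemma (in prob_space) AE_indep_neq:
  fixes X Y :: "'a \<Rightarrow> real"
  assumes ind: "indep_var borel Y borel X"
    and X: "\<And>a. a \<in> A \<Longrightarrow> measure (distr M borel X) {a} = 0" and [measurable]: "A \<in> sets borel"
  shows "AE \<omega> in M. Y \<omega> \<in> A \<longrightarrow> X \<omega> \<noteq> Y \<omega>"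
proof -
  have [measurable]: "X \<in> borel_measurable M" "Y \<in> borel_measurable M"
    using indep_var_rv1[OF ind] indep_var_rv2[OF ind] by auto
  interpret X: prob_space "distr M borel X" by (rule prob_space_distr) simp
  interpret Y: prob_space "distr M borel Y" by (rule prob_space_distr) simp
  interpret XY: pair_prob_space "distr M borel Y" "distr M borel X" ..
  have "AE z in distr M borel Y \<Otimes>\<^sub>M distr M borel X. fst z \<in> A \<longrightarrow> snd z \<noteq> fst z"
  proof (rule XY.AE_pair_measure)
    show "AE y in distr M borel Y. AE x in distr M borel X. fst (y, x) \<in> A \<longrightarrow> snd (y, x) \<noteq> fst (y, x)"
    proof (rule AE_I2)
      fix y
      show "AE x in distr M borel X. fst (y, x) \<in> A \<longrightarrow> snd (y, x) \<noteq> fst (y, x)"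
      proof (cases "y \<in> A")
        case True
        then have "AE x in distr M borel X. x \<notin> {y}"
          using X[of y] by (subst X.prob_eq_0[symmetric]) auto
        then show ?thesis by auto
      qed simp
    qed
  qed measurable
  then have "AE z in distr M (borel \<Otimes>\<^sub>M borel) (\<lambda>\<omega>. (Y \<omega>, X \<omega>)). fst z \<in> A \<longrightarrow> snd z \<noteq> fst z"
    using ind[unfolded indep_var_distribution_eq] by (elim conjE) (simp only:)
  then show ?thesis by (subst (asm) AE_distr_iff) auto
qed

lemma LL_served_measurable:
  assumes [measurable]: "\<And>s. s < d \<Longrightarrow> L s \<in> borel_measurable N" "\<And>s. s < d \<Longrightarrow> V s \<in> borel_measurable N"
    "\<And>s. s < d \<Longrightarrow> Measurable.pred N (A s)" and "s < d"
  shows "Measurable.pred N (\<lambda>\<omega>. s \<in> LL_served {s. s < d \<and> A s \<omega>} k (\<lambda>s. L s \<omega>) (\<lambda>s. V s \<omega>))"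
proof -
  have [measurable]: "L s \<in> borel_measurable N" "V s \<in> borel_measurable N" "Measurable.pred N (A s)"
    using assms by auto
  define c where "c = (\<lambda>\<omega>. card {r. r < d \<and> (A r \<omega> \<and> (L r \<omega> < L s \<omega> \<or> L r \<omega> = L s \<omega> \<and> V r \<omega> < V s \<omega>))})"
  define n where "n = (\<lambda>\<omega>. card {s. s < d \<and> A s \<omega>})"
  have [measurable]: "c \<in> measurable N (count_space UNIV)" "n \<in> measurable N (count_space UNIV)"
    unfolding c_def n_def by (rule measurable_card; simp; measurable)+
  have "Measurable.pred N (\<lambda>\<omega>. A s \<omega> \<and> real (c \<omega>) < real (n \<omega>) \<and> real (c \<omega>) < real k)"
    using \<open>s < d\<close> by measurable
  then show ?thesis
    using \<open>s < d\<close> by (simp add: LL_served_def c_def n_def)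
qed

section \<open>Binomial sums and thinning\<close>

lemma sum_Pow_card:
  fixes f :: "nat \<Rightarrow> real"
  assumes "finite S"
  shows "(\<Sum>A\<in>Pow S. f (card A)) = (\<Sum>m\<le>card S. real (card S choose m) * f m)"
proof -
  have "(\<Sum>A\<in>Pow S. f (card A)) = (\<Sum>m\<le>card S. \<Sum>A | A \<in> Pow S \<and> card A = m. f (card A))"
    using assms by (intro sum.group[symmetric]) (auto simp: card_mono)
  also have "\<dots> = (\<Sum>m\<le>card S. real (card S choose m) * f m)"
    using n_subsets[OF assms] by (intro sum.cong) auto
  finally show ?thesis .
qed

text \<open>Keeping each of a binomial number of available servers with probability \<open>x\<close>
  leaves a binomial number with success probability \<open>q * x\<close>. As a polynomial identity
  it holds for all real \<open>q\<close> and \<open>x\<close>.\<close>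

lemma binomial_thinning:
  fixes q x :: real
  assumes "m \<le> d"
  shows "(\<Sum>j=m..d. B q j d * (real (j choose m) * (1 - x) ^ (j - m) * x ^ m))
    = real (d choose m) * (q * x) ^ m * (1 - q * x) ^ (d - m)"
proof -
  have "(\<Sum>j=m..d. B q j d * (real (j choose m) * (1 - x) ^ (j - m) * x ^ m))
      = (\<Sum>j=0..d-m. B q (j + m) d * (real (j + m choose m) * (1 - x) ^ j * x ^ m))"
    using sum.shift_bounds_cl_nat_ivl[of "\<lambda>j. B q j d * (real (j choose m) * (1 - x) ^ (j - m) * x ^ m)" 0 m "d - m"] assms
    by simp
  also have "\<dots> = (\<Sum>j\<le>d-m. real (d choose m) * (q * x) ^ m * (real (d - m choose j) * (q * (1 - x)) ^ j * (1 - q) ^ (d - m - j)))"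
  proof (rule sum.cong)
    fix j assume "j \<in> {..d - m}"
    \<comment> \<open>Choosing \<open>j + m\<close> of \<open>d\<close> and then \<open>m\<close> of
      these amounts to choosing the \<open>m\<close> first and the other \<open>j\<close> among the
      remaining \<open>d - m\<close>.\<close>
    then have "(d choose (j + m)) * (j + m choose m) = (d choose m) * (d - m choose j)"
      using choose_mult[of m "j + m" d] assms by simp
    then have "real (d choose (j + m)) * real (j + m choose m) = real (d choose m) * real (d - m choose j)"
      by (simp only: of_nat_mult[symmetric])
    moreover have "d - (j + m) = d - m - j" by simp
    ultimately show "B q (j + m) d * (real (j + m choose m) * (1 - x) ^ j * x ^ m)
        = real (d choose m) * (q * x) ^ m * (real (d - m choose j) * (q * (1 - x)) ^ j * (1 - q) ^ (d - m - j))"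
      by (simp add: B_def power_add power_mult_distrib mult_ac)
  qed auto
  also have "\<dots> = real (d choose m) * (q * x) ^ m * (q * (1 - x) + (1 - q)) ^ (d - m)"
    by (simp add: binomial_ring sum_distrib_left)
  also have "q * (1 - x) + (1 - q) = 1 - q * x" by (simp add: algebra_simps)
  finally show ?thesis .
qed

text \<open>Both sums run over the triangle \<open>1 \<le> m \<le> j \<le> d\<close>; after
  exchanging them, thinning applies to the inner one. The right side is how the expectation is
  computed, the left side how the claimed equation writes it.\<close>

lemma binomial_thinning_sum:
  fixes q x :: real
  shows "(\<Sum>j=1..d. B q j d * (\<Sum>m=1..j. f m * real (j choose m) * (1 - x) ^ (j - m) * x ^ m))
    = (\<Sum>m=1..d. f m * (real (d choose m) * (q * x) ^ m * (1 - q * x) ^ (d - m)))"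
proof -
  have "(\<Sum>j=1..d. B q j d * (\<Sum>m=1..j. f m * real (j choose m) * (1 - x) ^ (j - m) * x ^ m))
      = (\<Sum>(j, m)\<in>(SIGMA j:{1..d}. {1..j}). B q j d * (f m * real (j choose m) * (1 - x) ^ (j - m) * x ^ m))"
    by (simp add: sum_distrib_left sum.Sigma)
  also have "\<dots> = (\<Sum>(m, j)\<in>(SIGMA m:{1..d}. {m..d}). B q j d * (f m * real (j choose m) * (1 - x) ^ (j - m) * x ^ m))"
    by (rule sum.reindex_bij_witness[where i = prod.swap and j = prod.swap]) auto
  also have "\<dots> = (\<Sum>m=1..d. f m * (\<Sum>j=m..d. B q j d * (real (j choose m) * (1 - x) ^ (j - m) * x ^ m)))"
    by (simp add: sum_distrib_left sum.Sigma[symmetric] mult_ac)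
  also have "\<dots> = (\<Sum>m=1..d. f m * (real (d choose m) * (q * x) ^ m * (1 - q * x) ^ (d - m)))"
    by (intro sum.cong) (simp_all add: binomial_thinning)
  finally show ?thesis .
qed

section \<open>Exchangeability of the selected servers\<close>

lemma (in prob_space) indep_var_of_indep_vars:
  assumes ind: "indep_vars (\<lambda>_. N) X I" and "i \<in> I" "j \<in> I" "i \<noteq> j"
  shows "indep_var N (X i) N (X j)"
proof -
  have "indep_var N ((\<lambda>f. f i) \<circ> (\<lambda>\<omega>. restrict (\<lambda>i. X i \<omega>) {i})) N ((\<lambda>f. f j) \<circ> (\<lambda>\<omega>. restrict (\<lambda>i. X i \<omega>) {j}))"
    using assms by (intro indep_var_compose[OF indep_var_restrict[OF ind]] measurable_component_singleton) auto
  then show ?thesis by (simp add: comp_def)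
qed

lemma measure_distr_Collect:
  assumes "f \<in> measurable M N" "Measurable.pred N P"
  shows "measure (distr M N f) {y \<in> space N. P y} = measure M {x \<in> space M. P (f x)}"
  using assms
  by (subst measure_distr) (auto dest: measurable_space intro!: arg_cong[where f = "measure M"])

text \<open>The law of a coordinate depends on its component \<open>c\<close> and not on the server
  \<open>s\<close>, so the product law is invariant under transposing servers 0 and
  \<open>s\<close>.\<close>

lemma (in prob_space) iid_transpose:
  fixes Y :: "nat \<times> nat \<Rightarrow> 'a \<Rightarrow> real" and s d :: nat
  defines "I \<equiv> {..<d} \<times> {..<3}"
  assumes ind: "indep_vars (\<lambda>_. borel) Y I"
    and dist: "\<And>s c. s < d \<Longrightarrow> c < 3 \<Longrightarrow> distr M borel (Y (s, c)) = \<nu> c"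
    and "s < d" and [measurable]: "Measurable.pred (Pi\<^sub>M I (\<lambda>_. borel)) \<Phi>"
  shows "prob {\<omega> \<in> space M. \<Phi> (\<lambda>x\<in>I. Y (Transposition.transpose 0 s (fst x), snd x) \<omega>)}
    = prob {\<omega> \<in> space M. \<Phi> (\<lambda>x\<in>I. Y x \<omega>)}"
proof -
  define \<tau> where "\<tau> = (\<lambda>x. (Transposition.transpose 0 s (fst x) :: nat, snd x :: nat))"
  define Q where "Q = Pi\<^sub>M I (\<lambda>x. distr M borel (Y x))"
  have "(s, 0) \<in> I" using \<open>s < d\<close> by (simp add: I_def)
  then have I: "I \<noteq> {}" by blast
  have Y [measurable]: "Y x \<in> borel_measurable M" if "x \<in> I" for x
    using ind that by (auto simp: indep_vars_def)
  have \<tau>: "\<tau> x \<in> I" if "x \<in> I" for x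
    using that \<open>s < d\<close> by (cases x) (auto simp: \<tau>_def I_def Transposition.transpose_def)
  have inj: "inj_on \<tau> I"
    by (auto simp: inj_on_def \<tau>_def) (metis transpose_involutory)
  have Q\<tau>: "Pi\<^sub>M I (\<lambda>x. distr M borel (Y (\<tau> x))) = Q"
    unfolding Q_def
  proof (intro PiM_cong refl)
    fix x assume "x \<in> I"
    then show "distr M borel (Y (\<tau> x)) = distr M borel (Y x)"
      using \<tau>[OF \<open>x \<in> I\<close>] dist by (cases x) (auto simp: I_def \<tau>_def)
  qed
  define P0 :: "(nat \<times> nat \<Rightarrow> real) measure" where "P0 = Pi\<^sub>M I (\<lambda>_. borel)"
  define t where "t = (\<lambda>y :: nat \<times> nat \<Rightarrow> real. \<lambda>x\<in>I. y (\<tau> x))"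
  have sQ: "sets Q = sets P0"
    unfolding Q_def P0_def by (intro sets_PiM_cong) auto
  note spQ = sets_eq_imp_space_eq[OF sQ]
  have law: "distr M P0 (\<lambda>\<omega>. \<lambda>x\<in>I. Y x \<omega>) = Q"
    using ind indep_vars_iff_distr_eq_PiM'[OF I, of Y "\<lambda>_. borel"] Y by (simp add: Q_def P0_def)
  have [measurable]: "(\<lambda>\<omega>. \<lambda>x\<in>I. Y x \<omega>) \<in> measurable M P0"
    unfolding P0_def by (intro measurable_restrict Y)
  have [measurable]: "t \<in> measurable P0 P0"
    unfolding P0_def t_def by (intro measurable_restrict measurable_component_singleton \<tau>)
  have [measurable]: "Measurable.pred P0 \<Phi>"
    using assms(5) by (simp add: P0_def)
  have t: "t \<in> measurable Q P0"
    by (simp add: measurable_cong_sets[OF sQ refl])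
  have "distr Q (Pi\<^sub>M I (\<lambda>x. distr M borel (Y (\<tau> x)))) (\<lambda>y. \<lambda>x\<in>I. y (\<tau> x))
      = Pi\<^sub>M I (\<lambda>x. distr M borel (Y (\<tau> x)))"
    unfolding Q_def using inj \<tau> Y
    by (intro distr_PiM_reindex) (auto intro!: prob_space_distr)
  then have inv: "distr Q P0 t = Q"
    unfolding Q\<tau> t_def using sQ by (metis distr_cong)
  have "prob {\<omega> \<in> space M. \<Phi> (\<lambda>x\<in>I. Y (\<tau> x) \<omega>)} = prob {\<omega> \<in> space M. \<Phi> (t (\<lambda>x\<in>I. Y x \<omega>))}"
    using \<tau> by (simp add: t_def cong: restrict_cong)
  also have "\<dots> = measure (distr M P0 (\<lambda>\<omega>. \<lambda>x\<in>I. Y x \<omega>)) {y \<in> space P0. \<Phi> (t y)}"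
    by (intro measure_distr_Collect[symmetric]) measurable
  also have "\<dots> = measure Q {y \<in> space Q. \<Phi> (t y)}"
    by (simp only: law spQ)
  also have "\<dots> = measure (distr Q P0 t) {y \<in> space P0. \<Phi> y}"
    by (intro measure_distr_Collect[symmetric] t) fact
  also have "\<dots> = measure (distr M P0 (\<lambda>\<omega>. \<lambda>x\<in>I. Y x \<omega>)) {y \<in> space P0. \<Phi> y}"
    by (simp only: inv law)
  also have "\<dots> = prob {\<omega> \<in> space M. \<Phi> (\<lambda>x\<in>I. Y x \<omega>)}"
    by (intro measure_distr_Collect) measurable
  finally show ?thesis by (simp add: \<tau>_def)
qed

text \<open>Below, \<open>Y (s, 0)\<close>, \<open>Y (s, 1)\<close> and \<open>Y (s, 2)\<close> are the workload, the priority and the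
  availability (1 if available) of server \<open>s\<close>.\<close>

lemma (in prob_space) prob_LL_served_exchange:
  fixes Y :: "nat \<times> nat \<Rightarrow> 'a \<Rightarrow> real" and s d k :: nat
  defines "Sv \<equiv> \<lambda>\<omega>. LL_served {s. s < d \<and> Y (s, 2) \<omega> = 1} k (\<lambda>s. Y (s, 0) \<omega>) (\<lambda>s. Y (s, 1) \<omega>)"
  assumes ind: "indep_vars (\<lambda>_. borel) Y ({..<d} \<times> {..<3})"
    and dist: "\<And>s c. s < d \<Longrightarrow> c < 3 \<Longrightarrow> distr M borel (Y (s, c)) = \<nu> c"
    and "s < d"
  shows "prob {\<omega> \<in> space M. s \<in> Sv \<omega> \<and> Y (s, 0) \<omega> \<le> u} = prob {\<omega> \<in> space M. 0 \<in> Sv \<omega> \<and> Y (0, 0) \<omega> \<le> u}"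
proof -
  define I :: "(nat \<times> nat) set" where "I = {..<d} \<times> {..<3}"
  define \<pi> where "\<pi> = Transposition.transpose 0 s"
  define \<Phi> where "\<Phi> = (\<lambda>y :: nat \<times> nat \<Rightarrow> real.
    s \<in> LL_served {s. s < d \<and> y (s, 2) = 1} k (\<lambda>s. y (s, 0)) (\<lambda>s. y (s, 1)) \<and> y (s, 0) \<le> u)"
  have comp: "(\<lambda>y. y (r, c)) \<in> borel_measurable (Pi\<^sub>M I (\<lambda>_. borel))" if "r < d" "c < 3" for r c
    by (rule measurable_component_singleton) (use that in \<open>simp add: I_def\<close>)
  have [measurable]: "Measurable.pred (Pi\<^sub>M I (\<lambda>_. borel)) \<Phi>"
  proof -
    have [measurable]: "(\<lambda>y. y (s, 0)) \<in> borel_measurable (Pi\<^sub>M I (\<lambda>_. borel))"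
      using \<open>s < d\<close> by (intro comp) auto
    have "Measurable.pred (Pi\<^sub>M I (\<lambda>_. borel)) (\<lambda>y. y (r, 2) = (1::real))" if "r < d" for r
    proof -
      have [measurable]: "(\<lambda>y. y (r, 2)) \<in> borel_measurable (Pi\<^sub>M I (\<lambda>_. borel))"
        using that by (intro comp) auto
      show ?thesis by measurable
    qed
    then have [measurable]: "Measurable.pred (Pi\<^sub>M I (\<lambda>_. borel))
        (\<lambda>y. s \<in> LL_served {s. s < d \<and> y (s, 2) = 1} k (\<lambda>s. y (s, 0)) (\<lambda>s. y (s, 1)))"
      using \<open>s < d\<close> by (intro LL_served_measurable comp) auto
    show ?thesis unfolding \<Phi>_def by measurable
  qed
  have \<pi>: "\<pi> r < d \<longleftrightarrow> r < d" for r
    using \<open>s < d\<close> by (auto simp: \<pi>_def Transposition.transpose_def)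
  have bij: "bij \<pi>" by (simp add: \<pi>_def)
  \<comment> \<open>Restriction to \<open>I\<close> alters functions outside \<open>I\<close>, where
    \<open>\<Phi>\<close> does not look.\<close>
  have \<Phi>_cong: "\<Phi> y \<longleftrightarrow> \<Phi> y'" if y: "\<And>r c. r < d \<Longrightarrow> c < 3 \<Longrightarrow> y (r, c) = y' (r, c)" for y y'
  proof -
    let ?J = "{s. s < d \<and> y (s, 2) = 1}"
    have J: "?J = {s. s < d \<and> y' (s, 2) = 1}" using y[of _ 2] by auto
    have "LL_served ?J k (\<lambda>s. y (s, 0)) (\<lambda>s. y (s, 1)) = LL_served ?J k (\<lambda>s. y' (s, 0)) (\<lambda>s. y' (s, 1))"
      by (rule LL_served_cong) (simp_all add: y)
    then show ?thesis
      using y[OF \<open>s < d\<close>, of 0] by (simp add: \<Phi>_def J)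
  qed
  \<comment> \<open>At transposed coordinates the statement \<open>\<Phi>\<close> about server
    \<open>s\<close> becomes the one about server 0, because \<open>\<pi>\<close> carries one set of
    available servers bijectively to the other.\<close>
  have L: "\<Phi> (\<lambda>x\<in>I. Y (\<pi> (fst x), snd x) \<omega>) \<longleftrightarrow> 0 \<in> Sv \<omega> \<and> Y (0, 0) \<omega> \<le> u" for \<omega>
  proof -
    let ?J = "{r. r < d \<and> Y (\<pi> r, 2) \<omega> = 1}"
    have img: "\<pi> ` ?J = {s. s < d \<and> Y (s, 2) \<omega> = 1}"
    proof safe
      fix r assume "r < d" "Y (r, 2) \<omega> = 1"
      then show "r \<in> \<pi> ` ?J"
        by (intro image_eqI[where x = "\<pi> r"]) (simp_all add: \<pi>, simp_all add: \<pi>_def)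
    qed (simp_all add: \<pi>)
    have s0: "\<pi> s = 0" by (simp add: \<pi>_def)
    have "s \<in> LL_served ?J k (\<lambda>r. Y (\<pi> r, 0) \<omega>) (\<lambda>r. Y (\<pi> r, 1) \<omega>) \<longleftrightarrow> 0 \<in> Sv \<omega>"
    proof (cases "s \<in> ?J")
      case True
      have "inj_on \<pi> ?J" using bij by (meson bij_is_inj inj_on_subset subset_UNIV)
      from LL_served_image[OF this True, of k "\<lambda>s. Y (s, 0) \<omega>" "\<lambda>s. Y (s, 1) \<omega>"]
      show ?thesis by (simp add: Sv_def img s0 comp_def)
    next
      case False
      then have "0 \<notin> {s. s < d \<and> Y (s, 2) \<omega> = 1}"
        using s0 \<open>s < d\<close> by auto
      with False show ?thesis
        using LL_served_subset[THEN subsetD] unfolding Sv_def by blast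
    qed
    then have "\<Phi> (\<lambda>x. Y (\<pi> (fst x), snd x) \<omega>) \<longleftrightarrow> 0 \<in> Sv \<omega> \<and> Y (0, 0) \<omega> \<le> u"
      by (simp add: \<Phi>_def s0)
    moreover have "\<Phi> (\<lambda>x\<in>I. Y (\<pi> (fst x), snd x) \<omega>) \<longleftrightarrow> \<Phi> (\<lambda>x. Y (\<pi> (fst x), snd x) \<omega>)"
      by (rule \<Phi>_cong) (simp add: I_def)
    ultimately show ?thesis by simp
  qed
  have R: "\<Phi> (\<lambda>x\<in>I. Y x \<omega>) \<longleftrightarrow> s \<in> Sv \<omega> \<and> Y (s, 0) \<omega> \<le> u" for \<omega>
  proof -
    have "\<Phi> (\<lambda>x\<in>I. Y x \<omega>) \<longleftrightarrow> \<Phi> (\<lambda>x. Y x \<omega>)"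
      by (rule \<Phi>_cong) (simp add: I_def)
    then show ?thesis by (simp add: \<Phi>_def Sv_def)
  qed
  show ?thesis
    using iid_transpose[OF ind dist \<open>s < d\<close>, of \<Phi>] \<open>Measurable.pred (Pi\<^sub>M I (\<lambda>_. borel)) \<Phi>\<close>
    by (simp add: L R flip: I_def \<pi>_def)
qed


text \<open>Linearity of expectation: the indicators add up to the count in
  \<open>card_LL_served_le\<close>. The injectivity required there holds almost surely, since
  independent priorities without atoms are distinct.\<close>

lemma (in prob_space) sum_prob_LL_served:
  fixes Y :: "nat \<times> nat \<Rightarrow> 'a \<Rightarrow> real" and d k :: nat and u :: real
  defines "Sv \<equiv> \<lambda>\<omega>. LL_served {s. s < d \<and> Y (s, 2) \<omega> = 1} k (\<lambda>s. Y (s, 0) \<omega>) (\<lambda>s. Y (s, 1) \<omega>)"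
    and "C \<equiv> \<lambda>\<omega>. {s. s < d \<and> Y (s, 2) \<omega> = 1 \<and> Y (s, 0) \<omega> \<le> u}"
  assumes ind: "indep_vars (\<lambda>_. borel) Y ({..<d} \<times> {..<3})"
    and dist: "\<And>s c. s < d \<Longrightarrow> c < 3 \<Longrightarrow> distr M borel (Y (s, c)) = \<nu> c"
    and atom: "\<And>a. measure (\<nu> 1) {a} = 0"
  shows "(\<Sum>s<d. prob {\<omega> \<in> space M. s \<in> Sv \<omega> \<and> Y (s, 0) \<omega> \<le> u})
    = (\<integral>\<omega>. real (min (card (C \<omega>)) k) \<partial>M)"
proof -
  have rv: "Y (s, c) \<in> borel_measurable M" if "s < d" "c < 3" for s c
    using ind that by (auto simp: indep_vars_def)
  have "AE \<omega> in M. Y (r, 1) \<omega> \<noteq> Y (s, 1) \<omega>" if "r < d" "s < d" "r \<noteq> s" for r s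
  proof -
    have "indep_var borel (Y (s, 1)) borel (Y (r, 1))"
      using that by (intro indep_var_of_indep_vars[OF ind]) auto
    from AE_indep_neq[OF this, of UNIV] show ?thesis
      using that by (simp add: dist atom del: One_nat_def)
  qed
  then have "AE \<omega> in M. \<forall>r\<in>{..<d}. \<forall>s\<in>{..<d}. r \<noteq> s \<longrightarrow> Y (r, 1) \<omega> \<noteq> Y (s, 1) \<omega>"
    by (intro AE_finite_allI AE_impI) auto
  from this AE_space have card: "AE \<omega> in M. (\<Sum>s<d. indicator {\<omega> \<in> space M. s \<in> Sv \<omega> \<and> Y (s, 0) \<omega> \<le> u} \<omega>) = real (min (card (C \<omega>)) k)"
  proof (eventually_elim, goal_cases)
    case (1 \<omega>)
    then have inj: "inj_on (\<lambda>s. Y (s, 1) \<omega>) {s. s < d \<and> Y (s, 2) \<omega> = 1}"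
      by (auto simp: inj_on_def)
    have "(\<Sum>s<d. indicator {\<omega> \<in> space M. s \<in> Sv \<omega> \<and> Y (s, 0) \<omega> \<le> u} \<omega>)
        = (\<Sum>s\<in>{..<d}. if s \<in> {s \<in> Sv \<omega>. Y (s, 0) \<omega> \<le> u} then 1 else 0 :: real)"
      using 1 by (intro sum.cong) (auto simp: indicator_def)
    also have "\<dots> = real (card ({..<d} \<inter> {s \<in> Sv \<omega>. Y (s, 0) \<omega> \<le> u}))"
      by (subst sum.inter_restrict[symmetric]) simp_all
    also have "{..<d} \<inter> {s \<in> Sv \<omega>. Y (s, 0) \<omega> \<le> u} = {s \<in> Sv \<omega>. Y (s, 0) \<omega> \<le> u}"
      using LL_served_subset by (fastforce simp: Sv_def)
    also have "card \<dots> = min (card (C \<omega>)) k"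
      using card_LL_served_le[OF _ inj] by (simp add: Sv_def C_def conj_assoc)
    finally show ?case .
  qed
  have ev [measurable]: "{\<omega> \<in> space M. s \<in> Sv \<omega> \<and> Y (s, 0) \<omega> \<le> u} \<in> events" if "s < d" for s
  proof -
    have [measurable]: "Y (s, 0) \<in> borel_measurable M"
      using that by (intro rv) auto
    have "Measurable.pred M (\<lambda>\<omega>. Y (r, 2) \<omega> = 1)" if "r < d" for r
    proof -
      have [measurable]: "Y (r, 2) \<in> borel_measurable M"
        using that by (intro rv) auto
      show ?thesis by measurable
    qed
    then have [measurable]: "Measurable.pred M (\<lambda>\<omega>. s \<in> Sv \<omega>)"
      unfolding Sv_def using that by (intro LL_served_measurable rv) auto
    show ?thesis by measurable
  qed
  have int: "integrable M (indicator {\<omega> \<in> space M. s \<in> Sv \<omega> \<and> Y (s, 0) \<omega> \<le> u} :: 'a \<Rightarrow> real)" if "s < d" for s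
    using ev[OF that] by (simp add: integrable_indicator_iff less_top[symmetric])
  have "(\<Sum>s<d. prob {\<omega> \<in> space M. s \<in> Sv \<omega> \<and> Y (s, 0) \<omega> \<le> u})
      = (\<Sum>s<d. \<integral>\<omega>. indicator {\<omega> \<in> space M. s \<in> Sv \<omega> \<and> Y (s, 0) \<omega> \<le> u} \<omega> \<partial>M)"
    using ev by (intro sum.cong) (auto simp: Int_absorb2)
  also have "\<dots> = (\<integral>\<omega>. (\<Sum>s<d. indicator {\<omega> \<in> space M. s \<in> Sv \<omega> \<and> Y (s, 0) \<omega> \<le> u} \<omega>) \<partial>M)"
    using int by (intro Bochner_Integration.integral_sum[symmetric]) auto
  also have "\<dots> = (\<integral>\<omega>. real (min (card (C \<omega>)) k) \<partial>M)"
  proof (intro integral_cong_AE)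
    have "{\<omega> \<in> space M. s \<in> C \<omega>} \<in> events" for s
    proof (cases "s < d")
      case True
      have [measurable]: "Y (s, 0) \<in> borel_measurable M" "Y (s, 2) \<in> borel_measurable M"
        using True by (auto intro!: rv)
      show ?thesis by (simp add: C_def)
    qed (simp add: C_def)
    then have "(\<lambda>\<omega>. card (C \<omega>)) \<in> measurable M (count_space UNIV)"
      by (rule measurable_card)
    then show "(\<lambda>\<omega>. real (min (card (C \<omega>)) k)) \<in> borel_measurable M"
      by (rule measurable_compose) simp
  qed (use int card in auto)
  finally show ?thesis .
qed

text \<open>The servers that are available with workload at most \<open>u\<close> form a random
  subset into which each server falls independently with probability \<open>q * x\<close>. Subsets
  are then grouped by size.\<close>

lemma (in prob_space) expectation_min_card:
  fixes Y :: "nat \<times> nat \<Rightarrow> 'a \<Rightarrow> real" and d k :: nat and u :: real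
  defines "C \<equiv> \<lambda>\<omega>. {s. s < d \<and> Y (s, 2) \<omega> = 1 \<and> Y (s, 0) \<omega> \<le> u}"
  assumes ind: "indep_vars (\<lambda>_. borel) Y ({..<d} \<times> {..<3})"
    and q: "\<And>s. s < d \<Longrightarrow> prob {\<omega> \<in> space M. Y (s, 2) \<omega> = 1} = q"
    and x: "\<And>s. s < d \<Longrightarrow> prob {\<omega> \<in> space M. Y (s, 0) \<omega> \<le> u} = x"
  shows "(\<integral>\<omega>. real (min (card (C \<omega>)) k) \<partial>M)
    = (\<Sum>m=1..d. real (min m k) * (real (d choose m) * (q * x) ^ m * (1 - q * x) ^ (d - m)))"
proof -
  have rv: "Y (s, c) \<in> borel_measurable M" if "s < d" "c < 3" for s c
    using ind that by (auto simp: indep_vars_def)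
  define T where "T = (\<lambda>s \<omega>. Y (s, 2) \<omega> = 1 \<and> Y (s, 0) \<omega> \<le> u)"
  have T_meas [measurable]: "Measurable.pred M (T s)" if "s < d" for s
  proof -
    have [measurable]: "Y (s, 0) \<in> borel_measurable M" "Y (s, 2) \<in> borel_measurable M"
      using that by (auto intro!: rv)
    show ?thesis unfolding T_def by measurable
  qed
  have pT: "prob {\<omega> \<in> space M. T s \<omega>} = q * x" if "s < d" for s
  proof -
    have "indep_var borel (Y (s, 2)) borel (Y (s, 0))"
      using that by (intro indep_var_of_indep_vars[OF ind]) auto
    from prob_indep_random_variable[OF this, of "{1}" "{..u}"] show ?thesis
      using that by (simp add: T_def q x)
  qed
  have indT: "indep_vars (\<lambda>_. count_space UNIV) T {..<d}"
  proof -
    let ?K = "\<lambda>s. {(s, 0), (s, 2)} :: (nat \<times> nat) set"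
    have "indep_vars (\<lambda>s. Pi\<^sub>M (?K s) (\<lambda>_. borel)) (\<lambda>s \<omega>. restrict (\<lambda>i. Y i \<omega>) (?K s)) {..<d}"
      by (rule indep_vars_restrict[OF ind]) (auto simp: disjoint_family_on_def)
    then have "indep_vars (\<lambda>_. count_space UNIV)
        (\<lambda>s \<omega>. (\<lambda>y. y (s, 2) = 1 \<and> y (s, 0) \<le> u) (restrict (\<lambda>i. Y i \<omega>) (?K s))) {..<d}"
    proof (rule indep_vars_compose2)
      fix s :: nat
      have [measurable]: "(\<lambda>y :: nat \<times> nat \<Rightarrow> real. y (s, 2)) \<in> borel_measurable (Pi\<^sub>M (?K s) (\<lambda>_. borel))"
        "(\<lambda>y :: nat \<times> nat \<Rightarrow> real. y (s, 0)) \<in> borel_measurable (Pi\<^sub>M (?K s) (\<lambda>_. borel))"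
        by (auto intro!: measurable_component_singleton)
      show "(\<lambda>y :: nat \<times> nat \<Rightarrow> real. y (s, 2) = 1 \<and> y (s, 0) \<le> u)
          \<in> measurable (Pi\<^sub>M (?K s) (\<lambda>_. borel)) (count_space UNIV)"
        by measurable
    qed
    then show ?thesis by (simp add: T_def[abs_def])
  qed
  have pC: "prob {\<omega> \<in> space M. C \<omega> = A} = (q * x) ^ card A * (1 - q * x) ^ (d - card A)"
    and mC: "{\<omega> \<in> space M. C \<omega> = A} \<in> events"
    if "A \<subseteq> {..<d}" for A
  proof -
    have eq: "{\<omega> \<in> space M. C \<omega> = A} = {\<omega> \<in> space M. \<forall>s\<in>{..<d}. T s \<omega> \<longleftrightarrow> s \<in> A}"
      using that by (auto simp: C_def T_def)
    have "{\<omega> \<in> space M. T s \<omega> \<longleftrightarrow> s \<in> A} \<in> events" if "s < d" for s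
      using T_meas[OF that] by measurable
    then show "{\<omega> \<in> space M. C \<omega> = A} \<in> events"
      unfolding eq by (intro sets.sets_Collect_finite_All) auto
    show "prob {\<omega> \<in> space M. C \<omega> = A} = (q * x) ^ card A * (1 - q * x) ^ (d - card A)"
    \<comment> \<open>With no servers the intersection below would run over an empty family, which
      the product formula for independent events excludes.\<close>
    proof (cases "d = 0")
      case True
      then show ?thesis using that by (simp add: C_def prob_space)
    next
      case False
      have neg: "prob {\<omega> \<in> space M. \<not> T s \<omega>} = 1 - q * x" if "s < d" for s
        using prob_neg[OF predE[OF T_meas[OF that]]] pT[OF that] by simp
      have "{\<omega> \<in> space M. C \<omega> = A} = (\<Inter>s\<in>{..<d}. T s -` {s \<in> A} \<inter> space M)"
        unfolding eq using False by auto
      also have "prob \<dots> = (\<Prod>s<d. prob (T s -` {s \<in> A} \<inter> space M))"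
        using False by (intro indep_varsD[OF indT]) auto
      also have "\<dots> = (\<Prod>s<d. if s \<in> A then q * x else 1 - q * x)"
      proof (rule prod.cong)
        fix s assume "s \<in> {..<d}"
        moreover have "T s -` {True} \<inter> space M = {\<omega> \<in> space M. T s \<omega>}"
          "T s -` {False} \<inter> space M = {\<omega> \<in> space M. \<not> T s \<omega>}" by auto
        ultimately show "prob (T s -` {s \<in> A} \<inter> space M) = (if s \<in> A then q * x else 1 - q * x)"
          by (cases "s \<in> A") (simp_all add: pT neg)
      qed simp
      also have "\<dots> = (q * x) ^ card A * (1 - q * x) ^ card ({..<d} - A)"
        using that by (subst prod.If_cases) (auto simp: Int_absorb1 Diff_eq)
      also have "card ({..<d} - A) = d - card A"
        using that by (subst card_Diff_subset) (auto intro: finite_subset)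
      finally show ?thesis .
    qed
  qed
  have "(\<integral>\<omega>. real (min (card (C \<omega>)) k) \<partial>M)
      = (\<integral>\<omega>. (\<Sum>A\<in>Pow {..<d}. real (min (card A) k) * indicator {\<omega> \<in> space M. C \<omega> = A} \<omega>) \<partial>M)"
  proof (intro Bochner_Integration.integral_cong refl)
    fix \<omega> assume "\<omega> \<in> space M"
    then have "(\<Sum>A\<in>Pow {..<d}. real (min (card A) k) * indicator {\<omega> \<in> space M. C \<omega> = A} \<omega>)
        = (\<Sum>A\<in>Pow {..<d}. if A = C \<omega> then real (min (card A) k) else 0)"
      by (intro sum.cong) (auto simp: indicator_def)
    also have "\<dots> = real (min (card (C \<omega>)) k)"
      by (subst sum.delta) (auto simp: C_def)
    finally show "real (min (card (C \<omega>)) k)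
      = (\<Sum>A\<in>Pow {..<d}. real (min (card A) k) * indicator {\<omega> \<in> space M. C \<omega> = A} \<omega>)" by simp
  qed
  also have "\<dots> = (\<Sum>A\<in>Pow {..<d}. real (min (card A) k) * prob {\<omega> \<in> space M. C \<omega> = A})"
    using mC by (subst Bochner_Integration.integral_sum)
      (auto intro!: integrable_mult_right sum.cong simp: integrable_indicator_iff less_top[symmetric] Int_absorb2)
  also have "\<dots> = (\<Sum>A\<in>Pow {..<d}. real (min (card A) k) * ((q * x) ^ card A * (1 - q * x) ^ (d - card A)))"
    by (intro sum.cong) (auto simp: pC)
  also have "\<dots> = (\<Sum>m\<le>d. real (d choose m) * (real (min m k) * ((q * x) ^ m * (1 - q * x) ^ (d - m))))"
    by (subst sum_Pow_card) auto
  \<comment> \<open>The term \<open>m = 0\<close> vanishes because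
    \<open>min 0 k = 0\<close>.\<close>
  also have "\<dots> = (\<Sum>m=1..d. real (min m k) * (real (d choose m) * (q * x) ^ m * (1 - q * x) ^ (d - m)))"
    by (rule sum.mono_neutral_cong_right) auto
  finally show ?thesis .
qed

text \<open>All \<open>d\<close> servers contribute equally to the expected count. The factor
  \<open>real d\<close> will be supplied by the arrival rate
  \<open>lam * p i * real (d i)\<close>.\<close>

lemma (in prob_space) prob_LL_served_le:
  fixes Y :: "nat \<times> nat \<Rightarrow> 'a \<Rightarrow> real" and d k :: nat and u :: real
  defines "Sv \<equiv> \<lambda>\<omega>. LL_served {s. s < d \<and> Y (s, 2) \<omega> = 1} k (\<lambda>s. Y (s, 0) \<omega>) (\<lambda>s. Y (s, 1) \<omega>)"
  assumes ind: "indep_vars (\<lambda>_. borel) Y ({..<d} \<times> {..<3})"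
    and dist: "\<And>s c. s < d \<Longrightarrow> c < 3 \<Longrightarrow> distr M borel (Y (s, c)) = \<nu> c"
    and atom: "\<And>a. measure (\<nu> 1) {a} = 0"
  shows "real d * prob {\<omega> \<in> space M. 0 \<in> Sv \<omega> \<and> Y (0, 0) \<omega> \<le> u}
    = (\<Sum>j=1..d. B (measure (\<nu> 2) {1}) j d *
        (\<Sum>m=1..j. real (min m k) * real (j choose m) * (1 - measure (\<nu> 0) {..u}) ^ (j - m) * measure (\<nu> 0) {..u} ^ m))"
proof -
  have rv: "Y (s, c) \<in> borel_measurable M" if "s < d" "c < 3" for s c
    using ind that by (auto simp: indep_vars_def)
  have q: "prob {\<omega> \<in> space M. Y (s, 2) \<omega> = 1} = measure (\<nu> 2) {1}" if "s < d" for s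
    using measure_distr[OF rv[OF that, of 2], of "{1}"] dist[OF that, of 2]
    by (simp add: vimage_def Int_def conj_commute)
  have x: "prob {\<omega> \<in> space M. Y (s, 0) \<omega> \<le> u} = measure (\<nu> 0) {..u}" if "s < d" for s
    using measure_distr[OF rv[OF that, of 0], of "{..u}"] dist[OF that, of 0]
    by (simp add: vimage_def Int_def conj_commute)
  have "real d * prob {\<omega> \<in> space M. 0 \<in> Sv \<omega> \<and> Y (0, 0) \<omega> \<le> u}
      = (\<Sum>s<d. prob {\<omega> \<in> space M. 0 \<in> Sv \<omega> \<and> Y (0, 0) \<omega> \<le> u})"
    by simp
  also have "\<dots> = (\<Sum>s<d. prob {\<omega> \<in> space M. s \<in> Sv \<omega> \<and> Y (s, 0) \<omega> \<le> u})"
    unfolding Sv_def by (intro sum.cong refl prob_LL_served_exchange[OF ind dist, symmetric]) auto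
  also have "\<dots> = (\<integral>\<omega>. real (min (card {s. s < d \<and> Y (s, 2) \<omega> = 1 \<and> Y (s, 0) \<omega> \<le> u}) k) \<partial>M)"
    unfolding Sv_def by (rule sum_prob_LL_served[OF ind dist atom])
  also have "\<dots> = (\<Sum>m=1..d. real (min m k) * (real (d choose m) *
      (measure (\<nu> 2) {1} * measure (\<nu> 0) {..u}) ^ m * (1 - measure (\<nu> 2) {1} * measure (\<nu> 0) {..u}) ^ (d - m)))"
    by (rule expectation_min_card[OF ind q x])
  finally show ?thesis
    by (simp only: binomial_thinning_sum)
qed

section \<open>Independence of generated sigma-algebras\<close>

lemma (in prob_space) indep_vars_reindex:
  assumes ind: "indep_vars (\<lambda>_. N) X I" and f: "inj_on f J" "f ` J \<subseteq> I"
  shows "indep_vars (\<lambda>_. N) (\<lambda>j. X (f j)) J"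
proof -
  have "indep_vars (\<lambda>j. Pi\<^sub>M {f j} (\<lambda>_. N)) (\<lambda>j \<omega>. restrict (\<lambda>i. X i \<omega>) {f j}) J"
    using f by (intro indep_vars_restrict[OF ind]) (auto simp: disjoint_family_on_def inj_on_def)
  then have "indep_vars (\<lambda>_. N) (\<lambda>j \<omega>. (\<lambda>y. y (f j)) (restrict (\<lambda>i. X i \<omega>) {f j})) J"
    by (rule indep_vars_compose2) (intro measurable_component_singleton, simp)
  then show ?thesis by simp
qed

text \<open>The sigma-algebra of the inputs with index in \<open>A\<close>. Being encoded as a
  measure, it makes dependence on these inputs alone an ordinary measurability statement.\<close>

definition (in prob_space) generated :: "('i \<Rightarrow> 'a \<Rightarrow> real) \<Rightarrow> 'i set \<Rightarrow> 'a measure" where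
  "generated Y A = vimage_algebra (space M) (\<lambda>\<omega>. \<lambda>x\<in>A. Y x \<omega>) (Pi\<^sub>M A (\<lambda>_. borel))"

lemma (in prob_space) space_generated [simp]: "space (generated Y A) = space M"
  by (simp add: generated_def)

lemma (in prob_space) measurable_generated:
  assumes "x \<in> A"
  shows "Y x \<in> borel_measurable (generated Y A)"
proof -
  have "(\<lambda>\<omega>. \<lambda>x\<in>A. Y x \<omega>) \<in> measurable (generated Y A) (Pi\<^sub>M A (\<lambda>_. borel))"
    unfolding generated_def by (rule measurable_vimage_algebra1) (auto simp: space_PiM)
  from measurable_compose[OF this measurable_component_singleton[OF assms]] show ?thesis
    using assms by simp
qed

text \<open>Functions of disjoint groups of independent inputs are independent. All later
  factorizations of probabilities by group of inputs come from here.\<close>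

lemma (in prob_space) generated_indep_var:
  fixes S T :: "'a \<Rightarrow> 'c"
  assumes ind: "indep_vars (\<lambda>_. borel) Y I" and AB: "A \<inter> C = {}" "A \<subseteq> I" "C \<subseteq> I"
    and S: "S \<in> measurable (generated Y A) N" and T: "T \<in> measurable (generated Y C) N'"
  shows "indep_var N S N' T"
proof -
  let ?R = "\<lambda>A \<omega>. \<lambda>x\<in>A. Y x \<omega>"
  have R: "?R A \<in> measurable M (Pi\<^sub>M A (\<lambda>_. borel))" if "A \<subseteq> I" for A
    using ind that by (intro measurable_restrict) (auto simp: indep_vars_def)
  have sets_generated: "sets (generated Y A) = {?R A -` X \<inter> space M | X. X \<in> sets (Pi\<^sub>M A (\<lambda>_. borel))}" for A
    unfolding generated_def by (rule sets_vimage_algebra2) (auto simp: space_PiM)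
  have sub: "sets (generated Y A) \<subseteq> events" if "A \<subseteq> I" for A
    unfolding sets_generated using R[OF that] by auto
  have meas: "f \<in> measurable M K" if "A \<subseteq> I" "f \<in> measurable (generated Y A) K" for f A and K :: "'c measure"
    using that(2) sub[OF that(1)] by (auto simp: measurable_def)
  have "indep_var (Pi\<^sub>M A (\<lambda>_. borel)) (?R A) (Pi\<^sub>M C (\<lambda>_. borel)) (?R C)"
    using AB by (intro indep_var_restrict[OF ind]) auto
  then have "indep_set (sigma_sets (space M) (sets (generated Y A))) (sigma_sets (space M) (sets (generated Y C)))"
    unfolding indep_var_eq sets_generated by simp
  moreover have "sigma_sets (space M) (sets (generated Y A)) = sets (generated Y A)" for A
    using sets.sigma_sets_eq[of "generated Y A"] by simp
  ultimately have *: "indep_set (sets (generated Y A)) (sets (generated Y C))"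
    by simp
  have "sigma_sets (space M) {S -` X \<inter> space M | X. X \<in> sets N} \<subseteq> sets (generated Y A)"
    by (rule sets.sigma_sets_subset[of _ "generated Y A", simplified]) (use measurable_sets[OF S] in auto)
  moreover have "sigma_sets (space M) {T -` X \<inter> space M | X. X \<in> sets N'} \<subseteq> sets (generated Y C)"
    by (rule sets.sigma_sets_subset[of _ "generated Y C", simplified]) (use measurable_sets[OF T] in auto)
  ultimately have "indep_set (sigma_sets (space M) {S -` X \<inter> space M | X. X \<in> sets N})
      (sigma_sets (space M) {T -` X \<inter> space M | X. X \<in> sets N'})"
    using * unfolding indep_sets2_eq by blast
  then show ?thesis
    using meas[OF AB(2) S] meas[OF AB(3) T] by (simp add: indep_var_eq)
qed

section \<open>Small and nearly equal probabilities\<close>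

lemma (in prob_space) prob_le_tendsto_0:
  fixes f :: "'a \<Rightarrow> real"
  assumes [measurable]: "f \<in> borel_measurable M" and pos: "AE \<omega> in M. 0 < f \<omega>"
  shows "((\<lambda>h. prob {\<omega> \<in> space M. f \<omega> \<le> h}) \<longlongrightarrow> 0) (at_right 0)"
proof -
  interpret D: real_distribution "distr M borel f"
    by (rule real_distribution_distr) simp
  have cdf: "cdf (distr M borel f) = (\<lambda>h. prob {\<omega> \<in> space M. f \<omega> \<le> h})"
    by (rule ext) (simp add: cdf_def measure_distr vimage_def Int_def conj_commute)
  have "prob {\<omega> \<in> space M. f \<omega> \<le> 0} = 0"
    using pos by (intro prob_eq_0_AE) auto
  with D.cdf_is_right_cont[of 0] show ?thesis
    by (simp add: continuous_within cdf)
qed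

text \<open>\<open>R\<close> holds the exceptions. Intersecting with \<open>E\<close> keeps the
  error small: with \<open>E\<close> the event of one arrival and \<open>R\<close> an independent
  event of vanishing probability, it is of smaller order than the window.\<close>

lemma (in prob_space) prob_diff_le:
  assumes [measurable]: "E \<in> events" "P \<in> events" "Q \<in> events" "R \<in> events"
    and *: "AE \<omega> in M. \<omega> \<in> E \<longrightarrow> \<omega> \<notin> R \<longrightarrow> (\<omega> \<in> P \<longleftrightarrow> \<omega> \<in> Q)"
  shows "\<bar>prob (P \<inter> E) - prob (Q \<inter> E)\<bar> \<le> prob (E \<inter> R)"
proof -
  have "prob (P \<inter> E) \<le> prob (Q \<inter> E) + prob (E \<inter> R)"
    if "P \<in> events" "Q \<in> events" "AE \<omega> in M. \<omega> \<in> E \<longrightarrow> \<omega> \<notin> R \<longrightarrow> (\<omega> \<in> P \<longleftrightarrow> \<omega> \<in> Q)" for P Q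
  proof -
    have "prob (P \<inter> E) \<le> prob (Q \<inter> E \<union> E \<inter> R)"
      using that by (intro finite_measure_mono_AE) auto
    also have "\<dots> \<le> prob (Q \<inter> E) + prob (E \<inter> R)"
      using that by (intro measure_Un_le) auto
    finally show ?thesis .
  qed
  moreover have "AE \<omega> in M. \<omega> \<in> E \<longrightarrow> \<omega> \<notin> R \<longrightarrow> (\<omega> \<in> Q \<longleftrightarrow> \<omega> \<in> P)"
    using * by eventually_elim auto
  ultimately have "prob (P \<inter> E) \<le> prob (Q \<inter> E) + prob (E \<inter> R)"
    "prob (Q \<inter> E) \<le> prob (P \<inter> E) + prob (E \<inter> R)"
    using * by simp_all
  then show ?thesis by linarith
qed

section \<open>Sample paths with one arrival\<close>

text \<open>The arrival instant is the infimum of the times with positive count.\<close>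

lemma point_at_exists:
  fixes c :: "real \<Rightarrow> nat"
  assumes "c 0 = 0" "mono_on {0..} c" "\<And>t. 0 \<le> t \<Longrightarrow> continuous (at_right t) c"
    and "0 < h" "c h = 1"
  obtains t where "0 < t" "t \<le> h" "point_at c 0 t" "\<And>s. 0 \<le> s \<Longrightarrow> s < t \<Longrightarrow> c s = 0"
    "\<And>s. t \<le> s \<Longrightarrow> s \<le> h \<Longrightarrow> c s = 1"
proof -
  define A where "A = {s. 0 \<le> s \<and> 1 \<le> c s}"
  define t where "t = Inf A"
  have "h \<in> A" using assms by (simp add: A_def)
  have bdd: "bdd_below A" by (auto simp: A_def bdd_below_def)
  have le: "t \<le> s" if "s \<in> A" for s
    unfolding t_def using that bdd by (rule cInf_lower)
  have t0: "0 \<le> t"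
    unfolding t_def using \<open>h \<in> A\<close> by (intro cInf_greatest) (auto simp: A_def)
  have mono: "c r \<le> c s" if "0 \<le> r" "r \<le> s" for r s
    using that assms(2) by (auto simp: mono_on_def)
  have below: "c s = 0" if "0 \<le> s" "s < t" for s
    using le[of s] that by (force simp: A_def)
  \<comment> \<open>The infimum is attained: a right-continuous path with discrete values is
    constant just after \<open>t\<close>, and \<open>A\<close> has members arbitrarily close to
    \<open>t\<close>.\<close>
  have "c t = 1"
  proof -
    have "eventually (\<lambda>s. c s = c t) (at_right t)"
      using assms(3)[OF t0] by (auto simp: continuous_within tendsto_discrete)
    then obtain b where b: "b > t" "\<And>s. t < s \<Longrightarrow> s < b \<Longrightarrow> c s = c t"
      unfolding eventually_at_right_field by blast
    obtain s where s: "s \<in> A" "s < b"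
      using cInf_lessD[of A b] \<open>h \<in> A\<close> b(1) unfolding t_def by blast
    have "1 \<le> c t"
    proof (cases "s = t")
      case False
      then show ?thesis using le[OF s(1)] b(2)[of s] s by (simp add: A_def)
    qed (use s in \<open>simp add: A_def\<close>)
    moreover have "c t \<le> 1"
      using mono[OF t0 le[OF \<open>h \<in> A\<close>]] assms(5) by simp
    ultimately show ?thesis by simp
  qed
  show thesis
  proof (rule that[of t])
    show "0 < t" using \<open>c t = 1\<close> t0 assms(1) by (cases "t = 0") auto
    then show "point_at c 0 t"
      using \<open>c t = 1\<close> below by (auto simp: point_at_def)
    show "t \<le> h" by (rule le) fact
    show "c s = 1" if "t \<le> s" "s \<le> h" for s
      using mono[of t s] mono[of s h] that t0 \<open>c t = 1\<close> assms(5) by simp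
  qed (fact below)
qed

text \<open>The jump rule speaks of some left limit \<open>v\<close>. Pure drift before the arrival
  determines it as \<open>max 0 (u 0 - t)\<close>, by uniqueness of limits. The predicate
  \<open>D\<close> stands for the decision whether the queue serves at workload
  \<open>v\<close>.\<close>

lemma path_one_arrival:
  fixes n :: "ftype \<Rightarrow> real \<Rightarrow> nat" and u :: "real \<Rightarrow> real" and i :: ftype
  assumes n: "\<And>i. n i 0 = 0" "\<And>i. mono_on {0..} (n i)" "\<And>i t. 0 \<le> t \<Longrightarrow> continuous (at_right t) (n i)"
    and "0 < h" "n i h = 1" "\<And>i'. i' \<noteq> i \<Longrightarrow> n i' h = 0"
    and drift: "\<And>s t. 0 \<le> s \<Longrightarrow> s \<le> t \<Longrightarrow> (\<And>i. n i s = n i t) \<Longrightarrow> u t = max 0 (u s - (t - s))"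
    and jump: "\<And>t. point_at (n i) 0 t \<Longrightarrow> \<exists>v. (u \<longlongrightarrow> v) (at_left t) \<and> u t = (if D v then v + x else v)"
  obtains t where "0 < t" "t \<le> h"
    "u h = max 0 ((if D (max 0 (u 0 - t)) then max 0 (u 0 - t) + x else max 0 (u 0 - t)) - (h - t))"
proof -
  obtain t where t: "0 < t" "t \<le> h" "point_at (n i) 0 t" "\<And>s. 0 \<le> s \<Longrightarrow> s < t \<Longrightarrow> n i s = 0"
    "\<And>s. t \<le> s \<Longrightarrow> s \<le> h \<Longrightarrow> n i s = 1"
    using point_at_exists[of "n i" h] n assms(4,5) by metis
  have other: "n j s = 0" if "j \<noteq> i" "0 \<le> s" "s \<le> h" for j s
    using mono_onD[OF n(2)[of j], of s h] assms(6)[OF that(1)] that by simp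
  have before: "u s = max 0 (u 0 - s)" if "0 \<le> s" "s < t" for s
    using drift[of 0 s] that t(4)[of s] t(2) n(1) other[of _ s] by (metis diff_zero less_imp_le less_le_trans order_refl)
  obtain v where v: "(u \<longlongrightarrow> v) (at_left t)" "u t = (if D v then v + x else v)"
    using jump[OF t(3)] by blast
  have "((\<lambda>s. max 0 (u 0 - s)) \<longlongrightarrow> max 0 (u 0 - t)) (at_left t)"
    by (intro tendsto_intros)
  moreover have "eventually (\<lambda>s. max 0 (u 0 - s) = u s) (at_left t)"
    unfolding eventually_at_left_field
    by (intro exI[of _ 0] conjI allI impI t(1) before[symmetric]) auto
  ultimately have "(u \<longlongrightarrow> max 0 (u 0 - t)) (at_left t)"
    by (rule Lim_transform_eventually)
  then have "v = max 0 (u 0 - t)"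
    by (intro tendsto_unique[OF _ v(1)]) auto
  moreover have "u h = max 0 (u t - (h - t))"
  proof (rule drift)
    show "n j t = n j h" for j
      using t(1,2,5) other[of j t] assms(5,6) by (cases "j = i") auto
  qed (use t in auto)
  ultimately show thesis
    using that[OF t(1,2)] v(2) by simp
qed

section \<open>The cavity queue at equilibrium\<close>

text \<open>Fixes the processes whose existence \<open>equilibrium_workload\<close> asserts, and
  represents the service laws by densities \<open>g\<close> supported on the nonnegative
  half-line.\<close>

locale cavity_equilibrium = prob_space M for M :: "'a measure" +
  fixes lam q :: real and p :: "ftype \<Rightarrow> real" and d k :: "ftype \<Rightarrow> nat"
    and X :: "ftype \<Rightarrow> real measure" and g :: "ftype \<Rightarrow> real \<Rightarrow> real" and F :: "real measure"
    and N :: "ftype \<Rightarrow> real \<Rightarrow> 'a \<Rightarrow> nat" and Av :: "ftype \<Rightarrow> nat \<Rightarrow> nat \<Rightarrow> 'a \<Rightarrow> bool"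
    and W V :: "ftype \<Rightarrow> nat \<Rightarrow> nat \<Rightarrow> 'a \<Rightarrow> real" and S :: "ftype \<Rightarrow> nat \<Rightarrow> 'a \<Rightarrow> real"
    and U :: "real \<Rightarrow> 'a \<Rightarrow> real"
  assumes lam_pos: "0 < lam" and q_pos: "0 < q" and q_le: "q \<le> 1" and p_nonneg: "\<And>i. 0 \<le> p i"
    and k_ge: "\<And>i. 1 \<le> k i" and k_le: "\<And>i. k i \<le> d i"
    and g_measurable [measurable]: "\<And>i. g i \<in> borel_measurable borel"
    and g_nonneg: "\<And>i x. 0 \<le> g i x" and g_neg: "\<And>i x. x < 0 \<Longrightarrow> g i x = 0"
    and X_density: "\<And>i. X i = density lborel (\<lambda>x. ennreal (g i x))"
    and workload: "workload_law F"
    and queue: "cavity_queue M lam p d k q X F N Av W V S U"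
    and stationary: "\<And>t. 0 \<le> t \<Longrightarrow> distr M borel (U t) = F"
begin

lemma U_measurable: "0 \<le> t \<Longrightarrow> U t \<in> borel_measurable M"
  using queue by (simp add: cavity_queue_def)

lemma N_poisson: "poisson_process M (lam * p i * real (d i)) (N i)"
  using queue by (simp add: cavity_queue_def)

lemma N_measurable: "0 \<le> t \<Longrightarrow> N i t \<in> measurable M (count_space UNIV)"
  using N_poisson by (simp add: poisson_process_def)

lemma Av_measurable: "s < d i \<Longrightarrow> Av i n s \<in> measurable M (count_space UNIV)"
  and Av_distr: "s < d i \<Longrightarrow> distr M (count_space UNIV) (Av i n s) = measure_pmf (bernoulli_pmf q)"
  using queue by (simp_all add: cavity_queue_def)

lemma W_measurable: "0 < s \<Longrightarrow> s < d i \<Longrightarrow> W i n s \<in> borel_measurable M"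
  and W_distr: "0 < s \<Longrightarrow> s < d i \<Longrightarrow> distr M borel (W i n s) = F"
  using queue by (auto simp: cavity_queue_def)

lemma V_measurable: "s < d i \<Longrightarrow> V i n s \<in> borel_measurable M"
  and V_distr: "s < d i \<Longrightarrow> distr M borel (V i n s) = uniform_measure lborel {0..1}"
  using queue by (simp_all add: cavity_queue_def)

lemma S_measurable [measurable]: "S i n \<in> borel_measurable M"
  and S_distr: "distr M borel (S i n) = X i"
  using queue by (simp_all add: cavity_queue_def)

lemma U0_measurable [measurable]: "U 0 \<in> borel_measurable M"
  by (rule U_measurable) simp

lemma F_prob: "prob_space F" and F_sets [measurable_cong, simp]: "sets F = sets borel"
  and F_neg: "measure F {..<0} = 0"
  using workload by (auto simp: workload_law_def)

lemma F_space [simp]: "space F = UNIV"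
  using sets_eq_imp_space_eq[OF F_sets] by simp

text \<open>The density describes \<open>F\<close> on the positive half-line only; at 0 there is an
  atom.\<close>

lemma F_no_atom: "0 < a \<Longrightarrow> measure F {a} = 0"
proof -
  assume "0 < a"
  obtain f where [measurable]: "f \<in> borel_measurable borel"
    and f: "\<And>A. A \<in> sets borel \<Longrightarrow> A \<subseteq> {0<..} \<Longrightarrow> emeasure F A = (\<integral>\<^sup>+ x \<in> A. ennreal (f x) \<partial>lborel)"
    using workload by (auto simp: workload_law_def)
  have "emeasure F {a} = (\<integral>\<^sup>+ x \<in> {a}. ennreal (f x) \<partial>lborel)"
    using \<open>0 < a\<close> by (intro f) auto
  also have "\<dots> = 0"
    by (simp add: nn_integral_indicator_singleton)
  finally show ?thesis by (simp add: measure_def)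
qed

lemma prob_U: "0 \<le> t \<Longrightarrow> prob {\<omega> \<in> space M. w < U t \<omega>} = ccdf F w"
  using measure_distr[OF U_measurable, of t "{w<..}"] stationary[of t]
  by (simp add: ccdf_def vimage_def Int_def conj_commute)

lemma ccdf_eq: "ccdf F w = 1 - measure F {..w}"
proof -
  interpret F: prob_space F by (rule F_prob)
  have "measure F (space F - {..w}) = 1 - measure F {..w}"
    by (rule F.prob_compl) simp
  then show ?thesis by (simp add: ccdf_def Compl_eq_Diff_UNIV[symmetric])
qed

lemma U0_nonneg: "AE \<omega> in M. 0 \<le> U 0 \<omega>"
proof -
  interpret F: prob_space F by (rule F_prob)
  have "AE x in F. x \<notin> {..<0}"
    using F_neg by (subst F.prob_eq_0[symmetric]) auto
  then have "AE x in distr M borel (U 0). 0 \<le> x"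
    unfolding stationary[OF order_refl] by eventually_elim auto
  then show ?thesis by (simp add: AE_distr_iff)
qed

lemma S_nonneg: "AE \<omega> in M. 0 \<le> S i n \<omega>"
proof -
  have "AE x in lborel. 0 < ennreal (g i x) \<longrightarrow> 0 \<le> x"
    using g_neg[of _ i] by (intro AE_I2) (metis ennreal_0 less_irrefl not_less)
  then have "AE x in X i. 0 \<le> x"
    unfolding X_density by (subst AE_density) auto
  then show ?thesis
    unfolding S_distr[of i n, symmetric] by (simp add: AE_distr_iff)
qed

lemma S_no_atom: "measure (distr M borel (S i n)) {a} = 0"
proof -
  have "emeasure (X i) {a} = (\<integral>\<^sup>+ x \<in> {a}. ennreal (g i x) \<partial>lborel)"
    unfolding X_density by (rule emeasure_density) auto
  then show ?thesis
    unfolding S_distr by (simp add: measure_def nn_integral_indicator_singleton)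
qed

text \<open>Real-valued codes of the inputs, so that one product law describes all of them; of an arrival
  process only the count in \<open>(0, h]\<close> is kept.\<close>

definition val :: "real \<Rightarrow> input \<Rightarrow> 'a \<Rightarrow> real" where
  "val h x \<omega> = (case x of Initial \<Rightarrow> U 0 \<omega> | Arrivals i \<Rightarrow> real (N i h \<omega>)
    | Avail i n s \<Rightarrow> of_bool (Av i n s \<omega>) | Load i n s \<Rightarrow> W i n s \<omega> | Prio i n s \<Rightarrow> V i n s \<omega>
    | Service i n \<Rightarrow> S i n \<omega>)"

text \<open>Independence passes to smaller sigma-algebras: each code is measurable for its input,
  and the count at \<open>h\<close> is one generator of the arrival sigma-algebra.\<close>

lemma val_indep:
  assumes h: "0 \<le> h"
  shows "indep_vars (\<lambda>_. borel) (val h) (inputs d)"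
  unfolding indep_vars_def2
proof
  show "\<forall>x\<in>inputs d. random_variable borel (val h x)"
    unfolding inputs_def val_def[abs_def]
    using U0_measurable N_measurable[OF h] Av_measurable W_measurable V_measurable S_measurable
    by (auto intro: measurable_compose[of _ M "count_space UNIV"])
  show "indep_sets (\<lambda>x. {val h x -` A \<inter> space M | A. A \<in> sets borel}) (inputs d)"
  proof (rule indep_sets_mono_sets)
    show "indep_sets (input_events M (U 0) N Av W V S) (inputs d)"
      using queue by (simp add: cavity_queue_def)
    fix x
    show "{val h x -` A \<inter> space M | A. A \<in> sets borel} \<subseteq> input_events M (U 0) N Av W V S x"
    proof (cases x)
      case (Arrivals i)
      have "val h x -` A \<inter> space M \<in> sets (vimage_algebra (space M) (N i h) (count_space UNIV))" for A
        using in_vimage_algebra[of "real -` A" "count_space UNIV" "N i h" "space M"]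
        by (simp add: Arrivals val_def[abs_def] vimage_def)
      then show ?thesis
        using h Arrivals by (auto intro!: sigma_sets.Basic)
    next
      case (Avail i n s)
      have "val h x -` A \<inter> space M \<in> sets (vimage_algebra (space M) (Av i n s) (count_space UNIV))" for A
        using in_vimage_algebra[of "of_bool -` A" "count_space UNIV" "Av i n s" "space M"]
        by (simp add: Avail val_def[abs_def] vimage_def)
      then show ?thesis using Avail by auto
    qed (auto simp: val_def[abs_def] intro!: in_vimage_algebra)
  qed
qed

section \<open>The servers selected at the first potential arrival\<close>

definition load :: "ftype \<Rightarrow> nat \<Rightarrow> 'a \<Rightarrow> real" where
  "load i s \<omega> = (if s = 0 then U 0 \<omega> else W i 0 s \<omega>)"

text \<open>The workload \<open>u\<close> of the cavity queue is an argument because the decision is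
  taken at the arrival instant, when it need not equal \<open>U 0\<close>. Only arrival number 0 of
  each type occurs: it is the one that a short window may contain.\<close>

definition serves :: "ftype \<Rightarrow> real \<Rightarrow> 'a \<Rightarrow> bool" where
  "serves i u \<omega> \<longleftrightarrow> 0 \<in> LL_served {s. s < d i \<and> Av i 0 s \<omega>} (k i) (\<lambda>s. if s = 0 then u else W i 0 s \<omega>) (\<lambda>s. V i 0 s \<omega>)"

abbreviation served :: "ftype \<Rightarrow> 'a \<Rightarrow> bool" where
  "served i \<omega> \<equiv> serves i (U 0 \<omega>) \<omega>"

text \<open>Places the inputs on the grid of servers and components used for exchangeability. The
  workload of server 0 is the initial state of the cavity queue.\<close>

definition emb :: "ftype \<Rightarrow> nat \<times> nat \<Rightarrow> input" where
  "emb i = (\<lambda>(s, c). if c = 0 then (if s = 0 then Initial else Load i 0 s)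
    else if c = 1 then Prio i 0 s else Avail i 0 s)"

abbreviation selection :: "ftype \<Rightarrow> (nat \<times> nat) set" where
  "selection i \<equiv> {..<d i} \<times> {..<3}"

lemma less_3_cases: "c < 3 \<Longrightarrow> c = 0 \<or> c = 1 \<or> c = (2::nat)"
  by auto

lemma emb_inj: "inj_on (emb i) (selection i)"
  by (auto simp: inj_on_def emb_def dest!: less_3_cases split: if_splits)

lemma emb_inputs: "emb i ` selection i \<subseteq> inputs d"
proof -
  have "emb i (s, c) \<in> inputs d" if "s < d i" for s c
    using that by (cases "c = 0"; cases "s = 0"; cases "c = 1") (auto simp: inputs_def emb_def)
  then show ?thesis by auto
qed

lemma d_pos: "0 < d i"
  using k_ge[of i] k_le[of i] by simp

lemma val_emb:
  "val h (emb i (s, 0)) = load i s" "val h (emb i (s, Suc 0)) = V i 0 s"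
  "val h (emb i (s, 2)) = (\<lambda>\<omega>. of_bool (Av i 0 s \<omega>))"
  by (auto simp: val_def[abs_def] emb_def load_def[abs_def])

lemma served_measurable:
  assumes "emb i ` selection i \<subseteq> A"
  shows "Measurable.pred (generated (val h) A) (served i)"
proof -
  have m: "val h (emb i (s, c)) \<in> borel_measurable (generated (val h) A)" if "s < d i" "c < 3" for s c
    using that assms by (intro measurable_generated) auto
  have L: "load i s \<in> borel_measurable (generated (val h) A)" if "s < d i" for s
    using m[of s 0] that by (simp add: val_emb)
  have V: "V i 0 s \<in> borel_measurable (generated (val h) A)" if "s < d i" for s
    using m[of s 1] that by (simp add: val_emb)
  have Av: "Measurable.pred (generated (val h) A) (Av i 0 s)" if "s < d i" for s
  proof -
    have "(\<lambda>\<omega>. of_bool (Av i 0 s \<omega>) :: real) \<in> borel_measurable (generated (val h) A)"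
      using m[of s 2] that by (simp add: val_emb)
    then have "Measurable.pred (generated (val h) A) (\<lambda>\<omega>. of_bool (Av i 0 s \<omega>) = (1::real))"
      by measurable
    then show ?thesis by simp
  qed
  show ?thesis
    using LL_served_measurable[of "d i" "load i" _ "V i 0" "Av i 0" 0 "k i", OF L V Av d_pos]
    by (simp add: serves_def[abs_def] load_def[abs_def])
qed

lemma selection_measurable:
  assumes "emb i ` selection i \<subseteq> A" "s < d i"
  shows "load i s \<in> borel_measurable (generated (val h) A)"
  using measurable_generated[of "emb i (s, 0)" A "val h"] assms by (force simp: val_emb)

lemma generated_mono:
  assumes "0 \<le> h" "A \<subseteq> inputs d" "f \<in> measurable (generated (val h) A) K"
  shows "f \<in> measurable M K"
proof -
  have "(\<lambda>\<omega>. \<lambda>x\<in>A. val h x \<omega>) \<in> measurable M (Pi\<^sub>M A (\<lambda>_. borel))"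
    using val_indep[OF assms(1)] assms(2) by (intro measurable_restrict) (auto simp: indep_vars_def)
  then have "sets (generated (val h) A) \<subseteq> events"
    unfolding generated_def by (subst sets_vimage_algebra2) (auto simp: space_PiM)
  then show ?thesis using assms(3) by (auto simp: measurable_def)
qed

lemma served_pred [measurable]: "Measurable.pred M (served i)"
  using generated_mono[OF order_refl emb_inputs served_measurable[OF order_refl]] .

text \<open>By stationarity \<open>U 0\<close> has the law \<open>F\<close> of the other workloads,
  so workloads, priorities and availabilities are identically distributed over all selected servers,
  including the cavity queue.\<close>

lemma prob_served_le:
  "real (d i) * prob {\<omega> \<in> space M. served i \<omega> \<and> U 0 \<omega> \<le> u}
    = (\<Sum>j=1..d i. B q j (d i) * (H F j (min j (k i)) u + 1))"
proof -
  define \<nu> where "\<nu> = (\<lambda>c :: nat. if c = 0 then F else if c = 1 then uniform_measure lborel {0..1}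
    else distr (measure_pmf (bernoulli_pmf q)) borel of_bool)"
  have ind: "indep_vars (\<lambda>_. borel) (\<lambda>x. val 0 (emb i x)) (selection i)"
    using val_indep[OF order_refl] emb_inj emb_inputs by (rule indep_vars_reindex)
  have dist: "distr M borel (val 0 (emb i (s, c))) = \<nu> c" if "s < d i" "c < 3" for s c
  proof -
    consider "c = 0" | "c = 1" | "c = 2" using \<open>c < 3\<close> by linarith
    then show ?thesis
    proof cases
      case 1
      then show ?thesis
        using that W_distr[of s i] stationary[of 0] by (cases "s = 0") (simp_all add: val_emb \<nu>_def load_def[abs_def])
    next
      case 2
      then show ?thesis using that V_distr[of s i] by (simp add: val_emb \<nu>_def)
    next
      case 3
      have "distr M borel (of_bool \<circ> Av i 0 s) = distr (distr M (count_space UNIV) (Av i 0 s)) borel of_bool"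
        using Av_measurable[OF \<open>s < d i\<close>] by (intro distr_distr[symmetric]) auto
      with 3 show ?thesis using that Av_distr[of s i] by (simp add: val_emb \<nu>_def comp_def)
    qed
  qed
  have atom: "measure (\<nu> 1) {a} = 0" for a
    by (simp add: \<nu>_def measure_def Int_insert_right)
  have \<nu>2: "measure (\<nu> 2) {1} = q"
  proof -
    have "measure (\<nu> 2) {1} = measure (measure_pmf (bernoulli_pmf q)) {True}"
      by (auto simp: \<nu>_def measure_distr intro!: arg_cong[where f = "measure_pmf.prob (bernoulli_pmf q)"])
    also have "\<dots> = q" using q_pos q_le by (simp add: measure_pmf_single)
    finally show ?thesis .
  qed
  have "served i \<omega> \<longleftrightarrow> 0 \<in> LL_served {s. s < d i \<and> val 0 (emb i (s, 2)) \<omega> = 1} (k i)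
      (\<lambda>s. val 0 (emb i (s, 0)) \<omega>) (\<lambda>s. val 0 (emb i (s, 1)) \<omega>)" for \<omega>
    by (simp add: val_emb serves_def load_def)
  then have "real (d i) * prob {\<omega> \<in> space M. served i \<omega> \<and> U 0 \<omega> \<le> u}
      = real (d i) * prob {\<omega> \<in> space M. 0 \<in> LL_served {s. s < d i \<and> val 0 (emb i (s, 2)) \<omega> = 1} (k i)
      (\<lambda>s. val 0 (emb i (s, 0)) \<omega>) (\<lambda>s. val 0 (emb i (s, 1)) \<omega>) \<and> val 0 (emb i (0, 0)) \<omega> \<le> u}"
    by (simp add: val_emb load_def)
  also have "\<dots> = (\<Sum>j=1..d i. B q j (d i) * (\<Sum>m=1..j. real (min m (k i)) * real (j choose m)
      * (1 - measure F {..u}) ^ (j - m) * measure F {..u} ^ m))"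
    using prob_LL_served_le[OF ind dist atom] unfolding \<nu>2 by (simp add: \<nu>_def)
  \<comment> \<open>For \<open>m \<le> j\<close> the caps \<open>k i\<close> and
    \<open>min j (k i)\<close> agree, and the added 1 cancels the one subtracted in
    \<open>H\<close>.\<close>
  also have "\<dots> = (\<Sum>j=1..d i. B q j (d i) * (H F j (min j (k i)) u + 1))"
    by (intro sum.cong refl arg_cong2[where f = "(*)"]) (auto simp: H_def ccdf_eq intro!: sum.cong)
  finally show ?thesis .
qed

end

section \<open>Arrivals in a short time window\<close>

lemma ftype_all: "(\<forall>i. P i) \<longleftrightarrow> P Hot \<and> P Cold"
  by (metis ftype.exhaust)

context cavity_equilibrium
begin

definition rate :: "ftype \<Rightarrow> real" where
  "rate i = lam * p i * real (d i)"

definition total_rate :: real where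
  "total_rate = rate Hot + rate Cold"

lemma rate_nonneg: "0 \<le> rate i"
  using lam_pos p_nonneg by (simp add: rate_def)

lemma N_path:
  "AE \<omega> in M. \<forall>i. N i 0 \<omega> = 0 \<and> mono_on {0..} (\<lambda>t. N i t \<omega>) \<and>
    (\<forall>t\<ge>0. continuous (at_right t) (\<lambda>s. N i s \<omega>))"
  unfolding ftype_all using N_poisson[of Hot] N_poisson[of Cold]
  by (intro AE_conjI) (auto simp: poisson_process_def)

lemma prob_N:
  assumes "0 \<le> h"
  shows "prob {\<omega> \<in> space M. N i h \<omega> = n} = exp (- (rate i * h)) * (rate i * h) ^ n / fact n"
proof -
  have [measurable]: "N i h \<in> measurable M (count_space UNIV)" "N i 0 \<in> measurable M (count_space UNIV)"
    using assms by (auto intro: N_measurable)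
  have "prob {\<omega> \<in> space M. N i h \<omega> = n} = prob {\<omega> \<in> space M. N i h \<omega> - N i 0 \<omega> = n}"
    using N_path by (intro finite_measure_eq_AE) auto
  also have "\<dots> = exp (- (rate i * (h - 0))) * (rate i * (h - 0)) ^ n / fact n"
    using N_poisson[of i] assms unfolding poisson_process_def rate_def by blast
  finally show ?thesis by simp
qed

definition arrivals :: "(ftype \<Rightarrow> nat) \<Rightarrow> real \<Rightarrow> 'a set" where
  "arrivals c h = {\<omega> \<in> space M. \<forall>i. N i h \<omega> = c i}"

abbreviation one :: "ftype \<Rightarrow> ftype \<Rightarrow> nat" where
  "one i j \<equiv> (if j = i then 1 else 0)"

lemma arrivals_generated:
  "Measurable.pred (generated (val h) (range Arrivals)) (\<lambda>\<omega>. \<forall>i. N i h \<omega> = c i)"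
proof -
  have [measurable]: "(\<lambda>\<omega>. real (N i h \<omega>)) \<in> borel_measurable (generated (val h) (range Arrivals))" for i
    using measurable_generated[of "Arrivals i" "range Arrivals" "val h"] by (simp add: val_def[abs_def])
  have "Measurable.pred (generated (val h) (range Arrivals))
      (\<lambda>\<omega>. real (N Hot h \<omega>) = real (c Hot) \<and> real (N Cold h \<omega>) = real (c Cold))"
    by measurable
  then show ?thesis by (simp add: ftype_all)
qed

lemma arrivals_inputs: "range Arrivals \<subseteq> inputs d"
  by (auto simp: inputs_def)

lemma arrivals_measurable [measurable]: "0 \<le> h \<Longrightarrow> arrivals c h \<in> events"
  using generated_mono[OF _ arrivals_inputs arrivals_generated] by (simp add: arrivals_def pred_def)

lemma prob_arrivals:
  assumes h: "0 \<le> h"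
  shows "prob (arrivals c h) = prob {\<omega> \<in> space M. N Hot h \<omega> = c Hot} * prob {\<omega> \<in> space M. N Cold h \<omega> = c Cold}"
proof -
  have "indep_var borel (val h (Arrivals Hot)) borel (val h (Arrivals Cold))"
    by (intro indep_var_of_indep_vars[OF val_indep[OF h]]) (auto simp: inputs_def)
  from prob_indep_random_variable[OF this, of "{real (c Hot)}" "{real (c Cold)}"] show ?thesis
    by (simp add: val_def arrivals_def ftype_all)
qed

lemma prob_arrivals_0: "0 \<le> h \<Longrightarrow> prob (arrivals (\<lambda>_. 0) h) = exp (- (total_rate * h))"
  by (simp add: prob_arrivals prob_N exp_add[symmetric] total_rate_def algebra_simps)

lemma prob_arrivals_1: "0 \<le> h \<Longrightarrow> prob (arrivals (one i) h) = rate i * h * exp (- (total_rate * h))"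
  by (cases i) (simp_all add: prob_arrivals prob_N exp_add[symmetric] total_rate_def algebra_simps)

text \<open>All inputs that decide the effect of the first arrival of type \<open>i\<close>. No
  arrival process is among them, so this effect is independent of the counts in the window.\<close>

definition influences :: "ftype \<Rightarrow> input set" where
  "influences i = insert (Service i 0) (emb i ` selection i)"

lemma influences_inputs: "influences i \<subseteq> inputs d"
  using emb_inputs[of i] by (auto simp: influences_def inputs_def)

lemma prob_arrivals_indep:
  assumes h: "0 \<le> h" and G: "Measurable.pred (generated (val h) (influences i)) G"
  shows "prob ({\<omega> \<in> space M. G \<omega>} \<inter> arrivals c h) = prob (arrivals c h) * prob {\<omega> \<in> space M. G \<omega>}"
proof -
  have "range Arrivals \<inter> influences i = {}"
    by (auto simp: influences_def emb_def split: if_splits)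
  then have "indep_var (count_space UNIV) (\<lambda>\<omega>. \<forall>i. N i h \<omega> = c i) (count_space UNIV) G"
    using generated_indep_var[OF val_indep[OF h] _ arrivals_inputs influences_inputs arrivals_generated G] by simp
  from prob_indep_random_variable[OF this, of "{True}" "{True}"]
  have "prob {\<omega> \<in> space M. (\<forall>i. N i h \<omega> = c i) \<and> G \<omega>} = prob (arrivals c h) * prob {\<omega> \<in> space M. G \<omega>}"
    by (simp add: arrivals_def)
  moreover have "{\<omega> \<in> space M. G \<omega>} \<inter> arrivals c h = {\<omega> \<in> space M. (\<forall>i. N i h \<omega> = c i) \<and> G \<omega>}"
    by (auto simp: arrivals_def)
  ultimately show ?thesis by simp
qed

lemma drift: "AE \<omega> in M. \<forall>s t. 0 \<le> s \<and> s \<le> t \<and> (\<forall>i. N i s \<omega> = N i t \<omega>) \<longrightarrow> U t \<omega> = max 0 (U s \<omega> - (t - s))"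
  using queue by (simp add: cavity_queue_def)

lemma jump: "AE \<omega> in M. \<forall>i t. point_at (\<lambda>s. N i s \<omega>) 0 t \<longrightarrow>
    (\<exists>v. ((\<lambda>s. U s \<omega>) \<longlongrightarrow> v) (at_left t) \<and> U t \<omega> = (if serves i v \<omega> then v + S i 0 \<omega> else v))"
proof -
  have "AE \<omega> in M. \<forall>i n t. point_at (\<lambda>s. N i s \<omega>) n t \<longrightarrow>
           (\<exists>u. ((\<lambda>s. U s \<omega>) \<longlongrightarrow> u) (at_left t) \<and>
              U t \<omega> = (if 0 \<in> LL_served {s. s < d i \<and> Av i n s \<omega>} (k i)
                                 (\<lambda>s. if s = 0 then u else W i n s \<omega>) (\<lambda>s. V i n s \<omega>)
                        then u + S i n \<omega> else u))"
    using queue by (simp add: cavity_queue_def)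
  then show ?thesis
    unfolding serves_def by eventually_elim blast
qed

lemma no_arrival:
  assumes "0 \<le> h"
  shows "AE \<omega> in M. \<omega> \<in> arrivals (\<lambda>_. 0) h \<longrightarrow> U h \<omega> = max 0 (U 0 \<omega> - h)"
  using drift N_path
proof eventually_elim
  case (elim \<omega>)
  then show ?case
    using elim(1)[rule_format, of 0 h] assms by (auto simp: arrivals_def)
qed

lemma one_arrival:
  assumes "0 < h"
  shows "AE \<omega> in M. \<omega> \<in> arrivals (one i) h \<longrightarrow> (\<exists>t v. 0 < t \<and> t \<le> h \<and> v = max 0 (U 0 \<omega> - t) \<and>
    U h \<omega> = max 0 ((if serves i v \<omega> then v + S i 0 \<omega> else v) - (h - t)))"
  using drift N_path jump
proof eventually_elim
  case (elim \<omega>)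
  show ?case
  proof
    assume "\<omega> \<in> arrivals (one i) h"
    then have a: "N i h \<omega> = 1" "\<And>i'. i' \<noteq> i \<Longrightarrow> N i' h \<omega> = 0"
      by (simp_all add: arrivals_def)
    obtain t where "0 < t" "t \<le> h" "U h \<omega> = max 0 ((if serves i (max 0 (U 0 \<omega> - t)) \<omega>
        then max 0 (U 0 \<omega> - t) + S i 0 \<omega> else max 0 (U 0 \<omega> - t)) - (h - t))"
    proof (rule path_one_arrival[of "\<lambda>i t. N i t \<omega>" h i "\<lambda>t. U t \<omega>" "\<lambda>v. serves i v \<omega>" "S i 0 \<omega>"])
      show "U t \<omega> = max 0 (U s \<omega> - (t - s))" if "0 \<le> s" "s \<le> t" "\<And>i. N i s \<omega> = N i t \<omega>" for s t
        using elim(1) that by blast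
    qed (use elim(2,3) a assms in auto)
    then show "\<exists>t v. 0 < t \<and> t \<le> h \<and> v = max 0 (U 0 \<omega> - t) \<and>
        U h \<omega> = max 0 ((if serves i v \<omega> then v + S i 0 \<omega> else v) - (h - t))"
      by blast
  qed
qed

text \<open>The workload moves by at most \<open>h\<close>, so it passes no workload that is farther
  than \<open>h\<close> away. If \<open>u = 0\<close> it does not move at all, and ties at 0 remain
  ties.\<close>

lemma serves_cong:
  assumes "0 < t" "t \<le> h" "0 \<le> u" "0 < u \<longrightarrow> h < u \<and> (\<forall>s\<in>{1..<d i}. h < \<bar>W i 0 s \<omega> - u\<bar>)"
  shows "serves i (max 0 (u - t)) \<omega> = serves i u \<omega>"
proof (cases "u = 0")
  case False
  define J where "J = {s. s < d i \<and> Av i 0 s \<omega>}"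
  define v where "v = max 0 (u - t)"
  define L where "L = (\<lambda>x s. if s = 0 then x else W i 0 s \<omega>)"
  have W: "h < \<bar>W i 0 s \<omega> - u\<bar>" if "s \<in> J" "s \<noteq> 0" for s
    using assms that False by (auto simp: J_def)
  have v: "v = u - t" using assms False by (simp add: v_def)
  have "{r \<in> J. L v r < L v 0 \<or> L v r = L v 0 \<and> V i 0 r \<omega> < V i 0 0 \<omega>}
      = {r \<in> J. L u r < L u 0 \<or> L u r = L u 0 \<and> V i 0 r \<omega> < V i 0 0 \<omega>}"
  proof (rule Collect_cong, rule conj_cong[OF refl])
    fix r assume "r \<in> J"
    show "(L v r < L v 0 \<or> L v r = L v 0 \<and> V i 0 r \<omega> < V i 0 0 \<omega>)
        = (L u r < L u 0 \<or> L u r = L u 0 \<and> V i 0 r \<omega> < V i 0 0 \<omega>)"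
    proof (cases "r = 0")
      case False
      from W[OF \<open>r \<in> J\<close> this] have "W i 0 r \<omega> < v \<longleftrightarrow> W i 0 r \<omega> < u" "W i 0 r \<omega> \<noteq> v" "W i 0 r \<omega> \<noteq> u"
        using assms(1,2) unfolding v by linarith+
      with False show ?thesis by (simp add: L_def)
    qed (simp add: L_def)
  qed
  then show ?thesis
    by (simp add: serves_def LL_served_def J_def L_def v_def)
qed (use assms in simp)

text \<open>The workload if the arrival came at time 0 and no work were done.\<close>

definition after :: "ftype \<Rightarrow> 'a \<Rightarrow> real" where
  "after i \<omega> = U 0 \<omega> + (if served i \<omega> then S i 0 \<omega> else 0)"

text \<open>Off this event the position of the arrival in a time window of length \<open>h\<close> affects neither
  whether the cavity queue serves a fragment nor on which side of \<open>w\<close> the workload ends up.\<close>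

definition critical :: "ftype \<Rightarrow> real \<Rightarrow> real \<Rightarrow> 'a \<Rightarrow> bool" where
  "critical i w h \<omega> \<longleftrightarrow> (if 0 < U 0 \<omega> then U 0 \<omega> else 1) \<le> h \<or>
    (\<exists>s\<in>{1..<d i}. (if 0 < U 0 \<omega> then \<bar>W i 0 s \<omega> - U 0 \<omega>\<bar> else 1) \<le> h) \<or> \<bar>after i \<omega> - w\<bar> \<le> h"

text \<open>At most \<open>h\<close> units of work are done in the window, so \<open>U h\<close>
  lies between \<open>after i - h\<close> and \<open>after i\<close>. If \<open>after i\<close> is
  farther than \<open>h\<close> from \<open>w\<close>, then \<open>U h\<close> is on the same side
  of every level in \<open>[w - h, w]\<close>.\<close>

lemma U_after_arrival:
  assumes h: "0 < h" and w': "w - h \<le> w'" "w' \<le> w" "0 \<le> w'"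
  shows "AE \<omega> in M. \<omega> \<in> arrivals (one i) h \<longrightarrow> \<not> critical i w h \<omega> \<longrightarrow> (w' < U h \<omega> \<longleftrightarrow> w < after i \<omega>)"
  using one_arrival[OF h, of i] U0_nonneg S_nonneg[of i 0]
proof eventually_elim
  case (elim \<omega>)
  show ?case
  proof (intro impI)
    assume "\<omega> \<in> arrivals (one i) h" and nc: "\<not> critical i w h \<omega>"
    with elim obtain t where t: "0 < t" "t \<le> h"
      and Uh: "U h \<omega> = max 0 ((if serves i (max 0 (U 0 \<omega> - t)) \<omega> then max 0 (U 0 \<omega> - t) + S i 0 \<omega>
        else max 0 (U 0 \<omega> - t)) - (h - t))" by blast
    have "serves i (max 0 (U 0 \<omega> - t)) \<omega> = served i \<omega>"
      using nc elim by (intro serves_cong[OF t]) (auto simp: critical_def)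
    with Uh have "U h \<omega> = max 0 ((max 0 (U 0 \<omega> - t) + (if served i \<omega> then S i 0 \<omega> else 0)) - (h - t))"
      by simp
    then have "after i \<omega> - h \<le> U h \<omega>" "U h \<omega> \<le> after i \<omega>"
      using t elim by (auto simp: after_def)
    moreover have "h < \<bar>after i \<omega> - w\<bar>"
      using nc by (simp add: critical_def)
    ultimately show "w' < U h \<omega> \<longleftrightarrow> w < after i \<omega>"
      using w' h by linarith
  qed
qed

lemma influences_measurable:
  shows "s < d i \<Longrightarrow> load i s \<in> borel_measurable (generated (val h) (influences i))"
    and "U 0 \<in> borel_measurable (generated (val h) (influences i))"
    and "S i 0 \<in> borel_measurable (generated (val h) (influences i))"
    and "Measurable.pred (generated (val h) (influences i)) (served i)"
    and "after i \<in> borel_measurable (generated (val h) (influences i))"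
proof -
  have sub: "emb i ` selection i \<subseteq> influences i" by (auto simp: influences_def)
  show L: "s < d i \<Longrightarrow> load i s \<in> borel_measurable (generated (val h) (influences i))" for s
    using selection_measurable[OF sub] .
  show U [measurable]: "U 0 \<in> borel_measurable (generated (val h) (influences i))"
    using L[OF d_pos] by (simp add: load_def[abs_def])
  show S [measurable]: "S i 0 \<in> borel_measurable (generated (val h) (influences i))"
    using measurable_generated[of "Service i 0" "influences i" "val h"] by (simp add: influences_def val_def[abs_def])
  show [measurable]: "Measurable.pred (generated (val h) (influences i)) (served i)"
    by (rule served_measurable[OF sub])
  show "after i \<in> borel_measurable (generated (val h) (influences i))"
    unfolding after_def[abs_def] by measurable
qed

lemma critical_measurable:
  "Measurable.pred (generated (val h') (influences i)) (critical i w h)"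
proof -
  note influences_measurable(2,5)[where i = i and h = h', measurable]
  have "Measurable.pred (generated (val h') (influences i))
      (\<lambda>\<omega>. \<exists>s\<in>{1..<d i}. (if 0 < U 0 \<omega> then \<bar>load i s \<omega> - U 0 \<omega>\<bar> else 1) \<le> h)"
  proof (rule pred_intros_finite(4))
    fix s assume "s \<in> {1..<d i}"
    then have [measurable]: "load i s \<in> borel_measurable (generated (val h') (influences i))"
      by (intro influences_measurable(1)) simp
    show "Measurable.pred (generated (val h') (influences i)) (\<lambda>\<omega>. (if 0 < U 0 \<omega> then \<bar>load i s \<omega> - U 0 \<omega>\<bar> else 1) \<le> h)"
      by measurable
  qed simp
  moreover have "(\<lambda>\<omega>. \<exists>s\<in>{1..<d i}. (if 0 < U 0 \<omega> then \<bar>load i s \<omega> - U 0 \<omega>\<bar> else 1) \<le> h)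
      = (\<lambda>\<omega>. \<exists>s\<in>{1..<d i}. (if 0 < U 0 \<omega> then \<bar>W i 0 s \<omega> - U 0 \<omega>\<bar> else 1) \<le> h)"
    by (intro ext bex_cong refl) (simp add: load_def)
  ultimately have [measurable]: "Measurable.pred (generated (val h') (influences i))
      (\<lambda>\<omega>. \<exists>s\<in>{1..<d i}. (if 0 < U 0 \<omega> then \<bar>W i 0 s \<omega> - U 0 \<omega>\<bar> else 1) \<le> h)"
    by (simp only:)
  show ?thesis
    unfolding critical_def[abs_def] by measurable
qed

lemma after_measurable [measurable]: "after i \<in> borel_measurable M"
  by (rule generated_mono[OF order_refl influences_inputs influences_measurable(5)])

text \<open>A critical outcome makes one of finitely many almost surely positive quantities at most
  \<open>h\<close>. For \<open>after i\<close> this uses that neither \<open>U 0\<close> nor the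
  independent sum \<open>U 0 + S i 0\<close> has an atom at \<open>w\<close>.\<close>

lemma prob_critical_tendsto:
  assumes "0 < w"
  shows "((\<lambda>h. prob {\<omega> \<in> space M. critical i w h \<omega>}) \<longlongrightarrow> 0) (at_right 0)"
proof -
  \<comment> \<open>The value 1 stands for an idle cavity queue, whose rank cannot change; any
    positive constant would serve.\<close>
  define f where "f = (\<lambda>\<omega>. if 0 < U 0 \<omega> then U 0 \<omega> else 1)"
  define g where "g = (\<lambda>s \<omega>. if 0 < U 0 \<omega> then \<bar>W i 0 s \<omega> - U 0 \<omega>\<bar> else 1)"
  have [measurable]: "f \<in> borel_measurable M" unfolding f_def by measurable
  have gm [measurable]: "g s \<in> borel_measurable M" if "s \<in> {1..<d i}" for s
  proof -
    have [measurable]: "W i 0 s \<in> borel_measurable M" using that by (intro W_measurable) auto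
    show ?thesis unfolding g_def by measurable
  qed
  have g0: "AE \<omega> in M. 0 < g s \<omega>" if "s \<in> {1..<d i}" for s
  proof -
    have "indep_var borel (val 0 Initial) borel (val 0 (Load i 0 s))"
      using that by (intro indep_var_of_indep_vars[OF val_indep[OF order_refl]]) (auto simp: inputs_def)
    then have "indep_var borel (U 0) borel (W i 0 s)" by (simp add: val_def[abs_def])
    from AE_indep_neq[OF this, of "{0<..}"] have "AE \<omega> in M. U 0 \<omega> \<in> {0<..} \<longrightarrow> W i 0 s \<omega> \<noteq> U 0 \<omega>"
      using that by (simp add: W_distr F_no_atom)
    then show ?thesis by eventually_elim (auto simp: g_def)
  qed
  have a0: "AE \<omega> in M. 0 < \<bar>after i \<omega> - w\<bar>"
  proof -
    have "measure (distr M borel (U 0)) {w} = 0"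
      using F_no_atom[OF assms] stationary[OF order_refl] by simp
    then have "AE \<omega> in M. U 0 \<omega> \<noteq> w"
      by (subst (asm) measure_distr)
         (auto simp: vimage_def Int_def conj_commute prob_eq_0 elim: eventually_mono)
    moreover have "AE \<omega> in M. w - U 0 \<omega> \<in> UNIV \<longrightarrow> S i 0 \<omega> \<noteq> w - U 0 \<omega>"
    proof (rule AE_indep_neq)
      have "indep_var borel (val 0 Initial) borel (val 0 (Service i 0))"
        by (intro indep_var_of_indep_vars[OF val_indep[OF order_refl]]) (auto simp: inputs_def)
      then have "indep_var borel ((\<lambda>x. w - x) \<circ> U 0) borel ((\<lambda>x. x) \<circ> S i 0)"
        by (intro indep_var_compose[where ?M1.0 = borel and ?M2.0 = borel]) (simp_all add: val_def[abs_def])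
      then show "indep_var borel (\<lambda>\<omega>. w - U 0 \<omega>) borel (S i 0)" by (simp add: comp_def)
    qed (simp_all add: S_no_atom)
    ultimately show ?thesis
      by eventually_elim (auto simp: after_def)
  qed
  let ?b = "\<lambda>h. prob {\<omega> \<in> space M. f \<omega> \<le> h} + (\<Sum>s\<in>{1..<d i}. prob {\<omega> \<in> space M. g s \<omega> \<le> h})
      + prob {\<omega> \<in> space M. \<bar>after i \<omega> - w\<bar> \<le> h}"
  have "(?b \<longlongrightarrow> 0 + 0 + 0) (at_right 0)"
    using g0 gm a0 by (intro tendsto_add tendsto_null_sum prob_le_tendsto_0) (auto simp: f_def)
  moreover
  have "prob {\<omega> \<in> space M. critical i w h \<omega>} \<le> ?b h" for h
  proof -
    let ?A = "{\<omega> \<in> space M. f \<omega> \<le> h}" and ?C = "\<lambda>s. {\<omega> \<in> space M. g s \<omega> \<le> h}"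
      and ?D = "{\<omega> \<in> space M. \<bar>after i \<omega> - w\<bar> \<le> h}"
    have [measurable]: "?C s \<in> events" if "s \<in> {1..<d i}" for s
      using gm[OF that] by measurable
    then have C: "(\<Union>s\<in>{1..<d i}. ?C s) \<in> events" by auto
    have "{\<omega> \<in> space M. critical i w h \<omega>} = ?A \<union> (\<Union>s\<in>{1..<d i}. ?C s) \<union> ?D"
      by (auto simp: critical_def f_def g_def)
    then have "prob {\<omega> \<in> space M. critical i w h \<omega>} \<le> prob (?A \<union> (\<Union>s\<in>{1..<d i}. ?C s)) + prob ?D"
      using C by (simp add: measure_Un_le)
    also have "\<dots> \<le> prob ?A + prob (\<Union>s\<in>{1..<d i}. ?C s) + prob ?D"
      using C by (simp add: measure_Un_le)
    also have "prob (\<Union>s\<in>{1..<d i}. ?C s) \<le> (\<Sum>s\<in>{1..<d i}. prob (?C s))"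
      using gm by (intro finite_measure_subadditive_finite) auto
    finally show ?thesis by simp
  qed
  then have "norm (prob {\<omega> \<in> space M. critical i w h \<omega>}) \<le> ?b h" for h
    by (simp only: real_norm_def abs_of_nonneg[OF measure_nonneg])
  ultimately show ?thesis
    using Lim_null_comparison[OF always_eventually, of "\<lambda>h. prob {\<omega> \<in> space M. critical i w h \<omega>}" ?b "at_right 0"]
    by (simp only: add_0_left simp_thms)
qed

end

section \<open>The derivative of the complementary distribution function\<close>

context cavity_equilibrium
begin

definition up_rate :: "real \<Rightarrow> real" where
  "up_rate w = (\<Sum>i\<in>{Hot, Cold}. rate i * prob {\<omega> \<in> space M. served i \<omega> \<and> U 0 \<omega> \<le> w \<and> w < U 0 \<omega> + S i 0 \<omega>})"

lemma prob_after:
  "prob {\<omega> \<in> space M. w < after i \<omega>}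
    = ccdf F w + prob {\<omega> \<in> space M. served i \<omega> \<and> U 0 \<omega> \<le> w \<and> w < U 0 \<omega> + S i 0 \<omega>}"
proof -
  let ?A = "{\<omega> \<in> space M. w < U 0 \<omega>}"
    and ?C = "{\<omega> \<in> space M. served i \<omega> \<and> U 0 \<omega> \<le> w \<and> w < U 0 \<omega> + S i 0 \<omega>}"
  have "prob {\<omega> \<in> space M. w < after i \<omega>} = prob (?A \<union> ?C)"
  proof (rule finite_measure_eq_AE)
    show "AE \<omega> in M. \<omega> \<in> {\<omega> \<in> space M. w < after i \<omega>} \<longleftrightarrow> \<omega> \<in> ?A \<union> ?C"
      using S_nonneg[of i 0] by eventually_elim (auto simp: after_def)
  qed measurable
  also have "\<dots> = prob ?A + prob ?C"
    by (rule finite_measure_Union) auto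
  finally show ?thesis by (simp add: prob_U)
qed

text \<open>Stationarity of the workload, written as a balance over a time window of length \<open>h\<close>
  according to the arrivals in the window; two or more arrivals contribute \<open>O(h\<^sup>2)\<close>.\<close>

lemma balance:
  assumes h: "0 < h" and w': "w - h \<le> w'" "w' \<le> w" "0 \<le> w'"
  shows "\<bar>ccdf F w' - exp (- (total_rate * h)) * ccdf F (w' + h)
      - (\<Sum>i\<in>{Hot, Cold}. rate i * h * exp (- (total_rate * h)) * prob {\<omega> \<in> space M. w < after i \<omega>})\<bar>
    \<le> (\<Sum>i\<in>{Hot, Cold}. rate i * h * prob {\<omega> \<in> space M. critical i w h \<omega>}) + (total_rate * h)\<^sup>2"
proof -
  have h0: "0 \<le> h" using h by simp
  define e where "e = exp (- (total_rate * h))"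
  define P where "P = {\<omega> \<in> space M. w' < U h \<omega>}"
  let ?a = "\<lambda>c. arrivals c h"
  let ?z = "?a (\<lambda>_. 0)"
  define R where "R = space M - ?z - ?a (one Hot) - ?a (one Cold)"
  have e: "0 \<le> e" "e \<le> 1"
    using rate_nonneg[of Hot] rate_nonneg[of Cold] h0 by (auto simp: e_def total_rate_def)
  have [measurable]: "U h \<in> borel_measurable M" "?a c \<in> events" for c
    using h0 by (auto intro: U_measurable)
  have [measurable]: "P \<in> events" "R \<in> events" by (simp_all add: P_def R_def)
  have disj: "?z \<inter> ?a (one Hot) = {}" "?z \<inter> ?a (one Cold) = {}" "?a (one Hot) \<inter> ?a (one Cold) = {}"
    by (auto simp: arrivals_def)
  have split: "prob Q = prob (Q \<inter> ?z) + prob (Q \<inter> ?a (one Hot)) + prob (Q \<inter> ?a (one Cold)) + prob (Q \<inter> R)"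
    if [measurable]: "Q \<in> events" for Q
  proof -
    have "Q = Q \<inter> ?z \<union> Q \<inter> ?a (one Hot) \<union> Q \<inter> ?a (one Cold) \<union> Q \<inter> R"
      using sets.sets_into_space[OF that] by (auto simp: R_def)
    then have "prob Q = prob (Q \<inter> ?z \<union> Q \<inter> ?a (one Hot) \<union> Q \<inter> ?a (one Cold) \<union> Q \<inter> R)"
      by (rule arg_cong)
    also have "\<dots> = prob (Q \<inter> ?z \<union> Q \<inter> ?a (one Hot) \<union> Q \<inter> ?a (one Cold)) + prob (Q \<inter> R)"
      by (rule finite_measure_Union) (auto simp: R_def)
    also have "prob (Q \<inter> ?z \<union> Q \<inter> ?a (one Hot) \<union> Q \<inter> ?a (one Cold))
        = prob (Q \<inter> ?z \<union> Q \<inter> ?a (one Hot)) + prob (Q \<inter> ?a (one Cold))"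
      using disj by (intro finite_measure_Union) auto
    also have "prob (Q \<inter> ?z \<union> Q \<inter> ?a (one Hot)) = prob (Q \<inter> ?z) + prob (Q \<inter> ?a (one Hot))"
      using disj by (intro finite_measure_Union) auto
    finally show ?thesis .
  qed
  have "prob R = 1 - e * (1 + total_rate * h)"
  proof -
    have sp: "space M \<inter> ?a c = ?a c" "space M \<inter> R = R" for c
      by (auto simp: arrivals_def R_def)
    show ?thesis
      using split[OF sets.top] prob_arrivals_0[OF h0] prob_arrivals_1[OF h0] unfolding sp
      by (simp add: prob_space e_def total_rate_def algebra_simps)
  qed
  \<comment> \<open>From \<open>exp (- x) \<ge> 1 - x\<close>; the product
    \<open>(1 - x) * (1 + x)\<close> leaves exactly the square.\<close>
  also have "\<dots> \<le> 1 - (1 - total_rate * h) * (1 + total_rate * h)"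
    using exp_ge_add_one_self[of "- (total_rate * h)"] rate_nonneg[of Hot] rate_nonneg[of Cold] h0
    by (intro diff_left_mono mult_right_mono) (auto simp: e_def total_rate_def)
  finally have R: "prob R \<le> (total_rate * h)\<^sup>2"
    by (simp add: algebra_simps power2_eq_square)
  have PR: "0 \<le> prob (P \<inter> R)" "prob (P \<inter> R) \<le> prob R"
    by (auto intro: finite_measure_mono)
  \<comment> \<open>Without arrivals \<open>U h\<close> is \<open>max 0 (U 0 - h)\<close>, which
    exceeds the nonnegative level \<open>w'\<close> iff \<open>U 0\<close> exceeds
    \<open>w' + h\<close>.\<close>
  have z: "prob (P \<inter> ?z) = e * ccdf F (w' + h)"
  proof -
    have "prob (P \<inter> ?z) = prob ({\<omega> \<in> space M. w' + h < U 0 \<omega>} \<inter> ?z)"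
    proof (rule finite_measure_eq_AE)
      show "AE \<omega> in M. \<omega> \<in> P \<inter> ?z \<longleftrightarrow> \<omega> \<in> {\<omega> \<in> space M. w' + h < U 0 \<omega>} \<inter> ?z"
        using no_arrival[OF h0] by eventually_elim (use w' in \<open>auto simp: P_def\<close>)
    qed measurable
    \<comment> \<open>\<open>U 0\<close> belongs to the influences of either type;
      \<open>Hot\<close> is an arbitrary choice.\<close>
    also have "\<dots> = prob ?z * prob {\<omega> \<in> space M. w' + h < U 0 \<omega>}"
    proof (rule prob_arrivals_indep[OF h0, where i = Hot])
      note influences_measurable(2)[measurable]
      show "Measurable.pred (generated (val h) (influences Hot)) (\<lambda>\<omega>. w' + h < U 0 \<omega>)" by measurable
    qed
    finally show ?thesis by (simp add: prob_arrivals_0[OF h0] e_def prob_U)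
  qed
  have one: "\<bar>prob (P \<inter> ?a (one i)) - rate i * h * e * prob {\<omega> \<in> space M. w < after i \<omega>}\<bar>
      \<le> rate i * h * prob {\<omega> \<in> space M. critical i w h \<omega>}" for i
  proof -
    have crit [measurable]: "Measurable.pred M (critical i w h)"
      by (rule generated_mono[OF h0 influences_inputs critical_measurable])
    have "prob ({\<omega> \<in> space M. w < after i \<omega>} \<inter> ?a (one i)) = prob (?a (one i)) * prob {\<omega> \<in> space M. w < after i \<omega>}"
    proof (rule prob_arrivals_indep[OF h0, where i = i])
      note influences_measurable(5)[measurable]
      show "Measurable.pred (generated (val h) (influences i)) (\<lambda>\<omega>. w < after i \<omega>)" by measurable
    qed
    moreover have "prob ({\<omega> \<in> space M. critical i w h \<omega>} \<inter> ?a (one i)) = prob (?a (one i)) * prob {\<omega> \<in> space M. critical i w h \<omega>}"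
      by (rule prob_arrivals_indep[OF h0 critical_measurable])
    moreover have "\<bar>prob (P \<inter> ?a (one i)) - prob ({\<omega> \<in> space M. w < after i \<omega>} \<inter> ?a (one i))\<bar>
        \<le> prob (?a (one i) \<inter> {\<omega> \<in> space M. critical i w h \<omega>})"
    proof (rule prob_diff_le)
      show "AE \<omega> in M. \<omega> \<in> ?a (one i) \<longrightarrow> \<omega> \<notin> {\<omega> \<in> space M. critical i w h \<omega>} \<longrightarrow>
          (\<omega> \<in> P \<longleftrightarrow> \<omega> \<in> {\<omega> \<in> space M. w < after i \<omega>})"
        using U_after_arrival[OF h w', of i] AE_space by eventually_elim (auto simp: P_def)
    qed measurable
    ultimately have "\<bar>prob (P \<inter> ?a (one i)) - rate i * h * e * prob {\<omega> \<in> space M. w < after i \<omega>}\<bar>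
        \<le> rate i * h * e * prob {\<omega> \<in> space M. critical i w h \<omega>}"
      by (simp add: prob_arrivals_1[OF h0] e_def Int_commute)
    also have "\<dots> \<le> rate i * h * 1 * prob {\<omega> \<in> space M. critical i w h \<omega>}"
      using e h0 rate_nonneg[of i] by (intro mult_right_mono mult_left_mono) auto
    finally show ?thesis by simp
  qed
  have P: "prob P = ccdf F w'"
    unfolding P_def by (rule prob_U[OF h0])
  have sum: "(\<Sum>i\<in>{Hot, Cold}. f i) = f Hot + f Cold" for f :: "ftype \<Rightarrow> real"
    by simp
  show ?thesis
    unfolding sum e_def[symmetric]
    using split[OF \<open>P \<in> events\<close>] one[of Hot] one[of Cold] R PR P z by linarith
qed

text \<open>The increment runs from \<open>w' h\<close> to \<open>w' h + h\<close>. The premise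
  \<open>lim\<close> is right-continuity when \<open>w' h = w\<close>, and trivial when
  \<open>w' h = w - h\<close>.\<close>

lemma ccdf_difference_quotient:
  assumes "0 < w" and w': "\<And>h. 0 < h \<Longrightarrow> w - h \<le> w' h" "\<And>h. 0 < h \<Longrightarrow> w' h \<le> w"
    and lim: "((\<lambda>h. ccdf F (w' h + h)) \<longlongrightarrow> ccdf F w) (at_right 0)"
  shows "((\<lambda>h. (ccdf F (w' h + h) - ccdf F (w' h)) / h) \<longlongrightarrow> - up_rate w) (at_right 0)"
proof -
  define A where "A = (\<lambda>i. prob {\<omega> \<in> space M. w < after i \<omega>})"
  define K where "K = (\<lambda>i h. prob {\<omega> \<in> space M. critical i w h \<omega>})"
  \<comment> \<open>The difference quotient that \<open>balance\<close> would give if its error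
    bound were 0.\<close>
  define f where "f = (\<lambda>h. (1 - exp (- (total_rate * h))) / h * ccdf F (w' h + h)
    - exp (- (total_rate * h)) * (rate Hot * A Hot + rate Cold * A Cold))"
  have "((\<lambda>x. 1 - exp (- (total_rate * x))) has_real_derivative total_rate) (at 0 within {0<..})"
    by (auto intro!: derivative_eq_intros)
  then have "((\<lambda>h. (1 - exp (- (total_rate * h))) / h) \<longlongrightarrow> total_rate) (at_right 0)"
    by (simp add: has_field_derivative_iff)
  then have "(f \<longlongrightarrow> total_rate * ccdf F w - exp (- (total_rate * 0)) * (rate Hot * A Hot + rate Cold * A Cold)) (at_right 0)"
    unfolding f_def by (intro tendsto_intros lim)
  \<comment> \<open>By \<open>prob_after\<close> each type contributes its rate times
    \<open>ccdf F w\<close>; together these cancel the first term and leave the jumps across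
    \<open>w\<close>.\<close>
  also have "total_rate * ccdf F w - exp (- (total_rate * 0)) * (rate Hot * A Hot + rate Cold * A Cold) = - up_rate w"
    by (simp add: up_rate_def A_def prob_after total_rate_def algebra_simps)
  finally have f: "(f \<longlongrightarrow> - up_rate w) (at_right 0)" .
  have "((\<lambda>h. rate Hot * K Hot h + rate Cold * K Cold h + total_rate\<^sup>2 * h)
      \<longlongrightarrow> rate Hot * 0 + rate Cold * 0 + total_rate\<^sup>2 * 0) (at_right 0)"
    unfolding K_def by (intro tendsto_intros prob_critical_tendsto \<open>0 < w\<close>)
  then have err: "((\<lambda>h. rate Hot * K Hot h + rate Cold * K Cold h + total_rate\<^sup>2 * h) \<longlongrightarrow> 0) (at_right 0)"
    by simp
  have "((\<lambda>h. (ccdf F (w' h + h) - ccdf F (w' h)) / h - f h) \<longlongrightarrow> 0) (at_right 0)"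
  proof (rule Lim_null_comparison[OF _ err])
    show "\<forall>\<^sub>F h in at_right 0. norm ((ccdf F (w' h + h) - ccdf F (w' h)) / h - f h)
        \<le> rate Hot * K Hot h + rate Cold * K Cold h + total_rate\<^sup>2 * h"
      unfolding eventually_at_right_field
    \<comment> \<open>Windows shorter than \<open>w\<close> keep the level \<open>w' h\<close>
      nonnegative, as \<open>balance\<close> requires.\<close>
    proof (intro exI[of _ w] conjI allI impI \<open>0 < w\<close>)
      fix h assume h: "0 < h" "h < w"
      have "0 \<le> w' h" using w'(1)[OF h(1)] h by simp
      let ?x = "exp (- (total_rate * h))"
      have "(ccdf F (w' h + h) - ccdf F (w' h)) / h - f h
          = - (ccdf F (w' h) - ?x * ccdf F (w' h + h) - (rate Hot * h * ?x * A Hot + rate Cold * h * ?x * A Cold)) / h"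
        using h by (simp add: f_def field_simps)
      also have "norm \<dots> \<le> (rate Hot * h * K Hot h + rate Cold * h * K Cold h + (total_rate * h)\<^sup>2) / h"
        using balance[OF h(1) w'[OF h(1)] \<open>0 \<le> w' h\<close>] h
        by (simp add: A_def K_def abs_divide divide_right_mono abs_minus_commute)
      also have "\<dots> = rate Hot * K Hot h + rate Cold * K Cold h + total_rate\<^sup>2 * h"
        using h by (simp add: field_simps power2_eq_square)
      finally show "norm ((ccdf F (w' h + h) - ccdf F (w' h)) / h - f h)
        \<le> rate Hot * K Hot h + rate Cold * K Cold h + total_rate\<^sup>2 * h" .
    qed
  qed
  from tendsto_add[OF this f] show ?thesis by simp
qed

lemma ccdf_right_continuous: "((\<lambda>h. ccdf F (w + h)) \<longlongrightarrow> ccdf F w) (at_right 0)"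
proof -
  interpret F: real_distribution F
    by (intro real_distribution.intro F_prob) (unfold_locales, simp)
  have "(cdf F \<longlongrightarrow> cdf F w) (at_right w)"
    using F.cdf_is_right_cont by (simp add: continuous_within)
  then have "((\<lambda>h. cdf F (w + h)) \<longlongrightarrow> cdf F w) (at_right 0)"
    by (simp add: filterlim_at_right_to_0[of _ _ w] add.commute)
  then have "((\<lambda>h. 1 - cdf F (w + h)) \<longlongrightarrow> 1 - cdf F w) (at_right 0)"
    by (intro tendsto_intros)
  then show ?thesis by (simp add: ccdf_eq cdf_def)
qed

lemma ccdf_derivative:
  assumes "0 < w"
  shows "(ccdf F has_real_derivative - up_rate w) (at w)"
proof -
  have r: "((\<lambda>h. (ccdf F (w + h) - ccdf F w) / h) \<longlongrightarrow> - up_rate w) (at_right 0)"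
    by (rule ccdf_difference_quotient[OF assms _ _ ccdf_right_continuous]) auto
  have "((\<lambda>h. (ccdf F (w - h + h) - ccdf F (w - h)) / h) \<longlongrightarrow> - up_rate w) (at_right 0)"
    by (rule ccdf_difference_quotient[OF assms]) auto
  then have "((\<lambda>h. (ccdf F (w + h) - ccdf F w) / h) \<longlongrightarrow> - up_rate w) (at_left 0)"
    by (simp add: filterlim_at_left_to_right minus_divide_right[symmetric] minus_divide_left)
  with r show ?thesis
    by (simp add: DERIV_def filterlim_split_at)
qed

end

section \<open>The integral form of the derivative\<close>

lemma set_integral_finite_sum:
  fixes f :: "'i \<Rightarrow> 'a \<Rightarrow> real"
  assumes "finite J" "\<And>j. set_integrable M A (f j)"
  shows "(LINT x:A|M. (\<Sum>j\<in>J. f j x)) = (\<Sum>j\<in>J. LINT x:A|M. f j x)"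
  using assms unfolding set_lebesgue_integral_def set_integrable_def scaleR_sum_right
  by (intro Bochner_Integration.integral_sum) auto

context cavity_equilibrium
begin

definition served_le :: "ftype \<Rightarrow> real \<Rightarrow> real" where
  "served_le i u = prob {\<omega> \<in> space M. served i \<omega> \<and> U 0 \<omega> \<le> u}"

lemma served_le_mono: "mono (served_le i)"
  unfolding served_le_def by (intro monoI finite_measure_mono) auto

lemma served_le_measurable [measurable]: "served_le i \<in> borel_measurable borel"
  by (rule borel_measurable_mono[OF served_le_mono])

lemma served_le_neg: "u < 0 \<Longrightarrow> served_le i u = 0"
  unfolding served_le_def using U0_nonneg by (intro prob_eq_0_AE) auto

lemma X_prob: "prob_space (X i)"
  using prob_space_distr[of "S i 0" borel] S_distr[of i 0] by simp

lemma X_sets [measurable_cong, simp]: "sets (X i) = sets borel"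
  by (simp add: X_density)

lemma g_integrable: "integrable lborel (g i)"
proof -
  interpret X: prob_space "X i" by (rule X_prob)
  have "(\<integral>\<^sup>+ x. ennreal (g i x) \<partial>lborel) = emeasure (X i) (space (X i))"
    unfolding X_density by (subst emeasure_density) (auto simp: nn_integral_density)
  then show ?thesis
    using g_nonneg X.emeasure_space_1 by (intro integrableI_nn_integral_finite[where x = 1]) auto
qed

lemma measure_X: "A \<in> sets borel \<Longrightarrow> measure (X i) A = (\<integral>x. g i x * indicator A x \<partial>lborel)"
proof -
  assume [measurable]: "A \<in> sets borel"
  have "measure (X i) A = (\<integral>x. indicator A x \<partial>X i)"
    by (simp add: X_density)
  also have "\<dots> = (\<integral>x. g i x *\<^sub>R indicator A x \<partial>lborel)"
    unfolding X_density using g_nonneg by (subst integral_density) auto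
  finally show ?thesis by simp
qed

text \<open>Whether a fragment is served depends on the selection but not on the service time, so
  integrating over the independent \<open>S i 0\<close> gives a convolution.\<close>

lemma prob_served_minus:
  "prob {\<omega> \<in> space M. served i \<omega> \<and> U 0 \<omega> \<le> w - S i 0 \<omega>} = (\<integral>x. served_le i (w - x) * g i x \<partial>lborel)"
proof -
  define T where "T = (\<lambda>\<omega>. (U 0 \<omega>, served i \<omega>))"
  \<comment> \<open>The constant component only gives \<open>R\<close> the value type of
    \<open>T\<close>, as \<open>indep_var\<close> relates variables of one type.\<close>
  define R where "R = (\<lambda>\<omega>. (S i 0 \<omega>, True))"
  let ?BB = "borel \<Otimes>\<^sub>M count_space UNIV :: (real \<times> bool) measure"
  have "Service i 0 \<in> inputs d" by (auto simp: inputs_def)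
  have ind: "indep_var ?BB R ?BB T"
  proof (rule generated_indep_var[OF val_indep[OF order_refl], of "{Service i 0}" "emb i ` selection i"])
    show "{Service i 0} \<inter> emb i ` selection i = {}"
      by (auto simp: emb_def split: if_splits)
    have "S i 0 \<in> borel_measurable (generated (val 0) {Service i 0})"
      using measurable_generated[of "Service i 0" "{Service i 0}" "val 0"] by (simp add: val_def[abs_def])
    then show "R \<in> measurable (generated (val 0) {Service i 0}) ?BB"
      unfolding R_def by (intro measurable_Pair) auto
    have "U 0 \<in> borel_measurable (generated (val 0) (emb i ` selection i))"
      using selection_measurable[OF order_refl d_pos, of i] by (simp add: load_def[abs_def])
    then show "T \<in> measurable (generated (val 0) (emb i ` selection i)) ?BB"
      unfolding T_def by (intro measurable_Pair served_measurable order_refl)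
  qed (use \<open>Service i 0 \<in> inputs d\<close> emb_inputs in auto)
  have T [measurable]: "T \<in> measurable M ?BB"
    by (rule indep_var_rv2[OF ind])
  have R [measurable]: "R \<in> measurable M ?BB"
    by (rule indep_var_rv1[OF ind])
  interpret T: prob_space "distr M ?BB T" by (rule prob_space_distr) fact
  let ?P = "\<lambda>z :: (real \<times> bool) \<times> real \<times> bool. snd (snd z) \<and> fst (snd z) \<le> w - fst (fst z)"
  have P: "Measurable.pred (?BB \<Otimes>\<^sub>M ?BB) ?P" by measurable
  then have [measurable]: "{z. ?P z} \<in> sets (?BB \<Otimes>\<^sub>M ?BB)"
    by (simp add: pred_def space_pair_measure)
  have "emeasure M {\<omega> \<in> space M. served i \<omega> \<and> U 0 \<omega> \<le> w - S i 0 \<omega>}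
      = emeasure (distr M (?BB \<Otimes>\<^sub>M ?BB) (\<lambda>\<omega>. (R \<omega>, T \<omega>))) {z. ?P z}"
    by (subst emeasure_distr) (auto simp: T_def R_def intro!: arg_cong[where f = "emeasure M"])
  also have "\<dots> = emeasure (distr M ?BB R \<Otimes>\<^sub>M distr M ?BB T) {z. ?P z}"
    using ind[unfolded indep_var_distribution_eq] by (elim conjE) (simp only:)
  also have "\<dots> = (\<integral>\<^sup>+ y. emeasure (distr M ?BB T) (Pair y -` {z. ?P z}) \<partial>distr M ?BB R)"
  proof (rule T.emeasure_pair_measure_alt)
    show "{z. ?P z} \<in> sets (distr M ?BB R \<Otimes>\<^sub>M distr M ?BB T)"
      by measurable
  qed
  also have "\<dots> = (\<integral>\<^sup>+ y. ennreal (served_le i (w - fst y)) \<partial>distr M ?BB R)"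
  proof (rule nn_integral_cong)
    fix y :: "real \<times> bool"
    have "emeasure (distr M ?BB T) (Pair y -` {z. ?P z}) = emeasure M (T -` (Pair y -` {z. ?P z}) \<inter> space M)"
      by (intro emeasure_distr T sets_Pair1[OF \<open>{z. ?P z} \<in> sets (?BB \<Otimes>\<^sub>M ?BB)\<close>])
    also have "T -` (Pair y -` {z. ?P z}) \<inter> space M = {\<omega> \<in> space M. served i \<omega> \<and> U 0 \<omega> \<le> w - fst y}"
      by (auto simp: T_def)
    finally show "emeasure (distr M ?BB T) (Pair y -` {z. ?P z}) = ennreal (served_le i (w - fst y))"
      by (simp add: served_le_def emeasure_eq_measure)
  qed
  also have "\<dots> = (\<integral>\<^sup>+ \<omega>. ennreal (served_le i (w - S i 0 \<omega>)) \<partial>M)"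
    by (subst nn_integral_distr) (simp_all add: R_def)
  also have "\<dots> = (\<integral>\<^sup>+ x. ennreal (served_le i (w - x)) \<partial>X i)"
    unfolding S_distr[of i 0, symmetric] by (subst nn_integral_distr) simp_all
  also have "\<dots> = (\<integral>\<^sup>+ x. ennreal (served_le i (w - x) * g i x) \<partial>lborel)"
    unfolding X_density using g_nonneg
    by (subst nn_integral_density) (auto simp: ennreal_mult' mult.commute served_le_def intro!: nn_integral_cong)
  finally show ?thesis
    using g_nonneg by (subst integral_eq_nn_integral) (auto simp: measure_def served_le_def)
qed

text \<open>Among the outcomes served at workload at most \<open>w\<close>, those that stay at most
  \<open>w\<close> after the jump are subtracted. Both convolution factors vanish at negative
  arguments, which confines the integral to \<open>[0, w]\<close>.\<close>

lemma prob_jump_over: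
  "prob {\<omega> \<in> space M. served i \<omega> \<and> U 0 \<omega> \<le> w \<and> w < U 0 \<omega> + S i 0 \<omega>}
    = served_le i w - (LBINT u:{0..w}. served_le i u * g i (w - u))"
proof -
  let ?A = "{\<omega> \<in> space M. served i \<omega> \<and> U 0 \<omega> \<le> w \<and> w < U 0 \<omega> + S i 0 \<omega>}"
    and ?C = "{\<omega> \<in> space M. served i \<omega> \<and> U 0 \<omega> \<le> w \<and> U 0 \<omega> \<le> w - S i 0 \<omega>}"
  have "served_le i w = prob (?A \<union> ?C)"
    unfolding served_le_def by (rule arg_cong[where f = prob]) auto
  also have "\<dots> = prob ?A + prob ?C"
    by (rule finite_measure_Union) auto
  \<comment> \<open>Service times are nonnegative, so \<open>U 0 \<le> w - S i 0\<close> already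
    implies \<open>U 0 \<le> w\<close>.\<close>
  also have "prob ?C = prob {\<omega> \<in> space M. served i \<omega> \<and> U 0 \<omega> \<le> w - S i 0 \<omega>}"
    using S_nonneg[of i 0] by (intro finite_measure_eq_AE) auto
  also have "\<dots> = (\<integral>x. served_le i (w - x) * g i x \<partial>lborel)"
    by (rule prob_served_minus)
  also have "\<dots> = (\<integral>u. served_le i u * g i (w - u) \<partial>lborel)"
    by (subst lborel_integral_real_affine[where t = w and c = "-1"]) auto
  also have "\<dots> = (LBINT u:{0..w}. served_le i u * g i (w - u))"
    unfolding set_lebesgue_integral_def
  proof (rule Bochner_Integration.integral_cong[OF refl])
    fix u show "served_le i u * g i (w - u) = indicator {0..w} u *\<^sub>R (served_le i u * g i (w - u))"
      using served_le_neg[of u i] g_neg[of "w - u" i] by (cases "u < 0"; cases "w < u") auto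
  qed
  finally show ?thesis by simp
qed

lemma ccdf_bounds: "0 \<le> ccdf F u" "ccdf F u \<le> 1"
proof -
  interpret F: prob_space F by (rule F_prob)
  show "0 \<le> ccdf F u" "ccdf F u \<le> 1" by (simp_all add: ccdf_def)
qed

lemma ccdf_measurable [measurable]: "ccdf F \<in> borel_measurable borel"
proof -
  interpret F: prob_space F by (rule F_prob)
  have "mono (\<lambda>u. measure F {..u})" by (intro monoI F.finite_measure_mono) auto
  from borel_measurable_mono[OF this] show ?thesis
    unfolding ccdf_eq[abs_def] by measurable
qed

lemma H_measurable [measurable]: "H F j K \<in> borel_measurable borel"
  unfolding H_def[abs_def] by measurable

text \<open>Bounds the product of \<open>H\<close> and \<open>g\<close> by a multiple of
  \<open>g\<close>, which lets the convolution be split term by term.\<close>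

lemma H_bounded: "\<bar>H F j K u\<bar> \<le> (\<Sum>m=1..j. real (min m K) * real (j choose m)) + 1"
proof -
  have "\<bar>real (min m K) * real (j choose m) * ccdf F u ^ (j - m) * (1 - ccdf F u) ^ m\<bar>
      \<le> real (min m K) * real (j choose m)" for m
  proof -
    have "ccdf F u ^ (j - m) * (1 - ccdf F u) ^ m \<le> 1"
      using ccdf_bounds[of u] by (intro mult_le_one power_le_one) auto
    then have "real (min m K) * real (j choose m) * (ccdf F u ^ (j - m) * (1 - ccdf F u) ^ m)
        \<le> real (min m K) * real (j choose m) * 1"
      by (intro mult_left_mono) auto
    then show ?thesis
      using ccdf_bounds[of u] by (simp add: abs_mult power_abs mult.assoc)
  qed
  then have "\<bar>\<Sum>m=1..j. real (min m K) * real (j choose m) * ccdf F u ^ (j - m) * (1 - ccdf F u) ^ m\<bar>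
      \<le> (\<Sum>m=1..j. real (min m K) * real (j choose m))"
    by (intro order_trans[OF sum_abs] sum_mono)
  then show ?thesis by (simp add: H_def)
qed

text \<open>The term \<open>ccdf (X i) w\<close> comes from the 1 added to \<open>H\<close> in
  \<open>prob_served_le\<close>: less its convolution with \<open>g i\<close> it is 1 minus the
  distribution function of the service time at \<open>w\<close>.\<close>

lemma prob_jump_over_eq:
  "real (d i) * prob {\<omega> \<in> space M. served i \<omega> \<and> U 0 \<omega> \<le> w \<and> w < U 0 \<omega> + S i 0 \<omega>}
    = (\<Sum>j=1..d i. B q j (d i) * (ccdf (X i) w + H F j (min j (k i)) w
        - (LBINT u:{0..w}. H F j (min j (k i)) u * g i (w - u))))"
proof -
  let ?H = "\<lambda>j. H F j (min j (k i))"
  let ?b = "\<lambda>j. B q j (d i)"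
  have s: "real (d i) * served_le i u = (\<Sum>j=1..d i. ?b j * (?H j u + 1))" for u
    unfolding served_le_def by (rule prob_served_le)
  have int: "integrable lborel (\<lambda>u. g i (w - u))"
    using lborel_integrable_real_affine[OF g_integrable[of i], of "-1" w] by simp
  have g_set: "set_integrable lborel {0..w} (\<lambda>u. g i (w - u))"
    unfolding set_integrable_def by (rule integrable_mult_indicator) (auto intro: int)
  have Hg_set: "set_integrable lborel {0..w} (\<lambda>u. ?H j u * g i (w - u))" for j
    unfolding set_integrable_def
  proof (rule integrable_mult_indicator)
    show "integrable lborel (\<lambda>u. ?H j u * g i (w - u))"
    proof (rule Bochner_Integration.integrable_bound)
      show "integrable lborel (\<lambda>u. ((\<Sum>m=1..j. real (min m (min j (k i))) * real (j choose m)) + 1) * g i (w - u))"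
        using int by (rule integrable_mult_right)
      show "AE u in lborel. norm (?H j u * g i (w - u))
          \<le> norm (((\<Sum>m=1..j. real (min m (min j (k i))) * real (j choose m)) + 1) * g i (w - u))"
        using H_bounded[of j "min j (k i)"] g_nonneg[of i]
        by (intro AE_I2) (auto simp: abs_mult sum_nonneg intro!: mult_right_mono)
    qed measurable
  qed simp
  interpret X: prob_space "X i" by (rule X_prob)
  have "(LBINT u:{0..w}. g i (w - u)) = (\<integral>u. indicator {..w} (w - u) * g i (w - u) \<partial>lborel)"
    unfolding set_lebesgue_integral_def
    by (rule Bochner_Integration.integral_cong[OF refl]) (use g_neg in \<open>auto simp: indicator_def not_le\<close>)
  also have "\<dots> = (\<integral>x. g i x * indicator {..w} x \<partial>lborel)"
    by (subst (2) lborel_integral_real_affine[where t = w and c = "-1"]) (auto simp: mult.commute)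
  also have "\<dots> = measure (X i) {..w}"
    by (simp add: measure_X)
  also have "\<dots> = 1 - ccdf (X i) w"
    using X.prob_compl[of "{w<..}"] sets_eq_imp_space_eq[OF X_sets[of i]]
    by (simp add: ccdf_def Compl_eq_Diff_UNIV[symmetric])
  finally have G: "(LBINT u:{0..w}. g i (w - u)) = 1 - ccdf (X i) w" .
  have "real (d i) * (LBINT u:{0..w}. served_le i u * g i (w - u))
      = (LBINT u:{0..w}. (\<Sum>j=1..d i. ?b j * (?H j u * g i (w - u) + g i (w - u))))"
    by (subst set_integral_mult_right[symmetric])
       (simp add: mult.assoc[symmetric] s sum_distrib_right distrib_left distrib_right)
  also have "\<dots> = (\<Sum>j=1..d i. ?b j * ((LBINT u:{0..w}. ?H j u * g i (w - u)) + (LBINT u:{0..w}. g i (w - u))))"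
    unfolding set_integral_finite_sum[OF finite_atLeastAtMost set_integrable_mult_right[OF set_integral_add(1)[OF Hg_set g_set]]]
      set_integral_mult_right set_integral_add(2)[OF Hg_set g_set] ..
  finally have "real (d i) * (LBINT u:{0..w}. served_le i u * g i (w - u))
      = (\<Sum>j=1..d i. ?b j * ((LBINT u:{0..w}. ?H j u * g i (w - u)) + (1 - ccdf (X i) w)))"
    by (simp only: G)
  then show ?thesis
    unfolding prob_jump_over right_diff_distrib s
    by (simp add: sum_subtractf[symmetric] algebra_simps)
qed

lemma up_rate_eq:
  "up_rate w = (\<Sum>i\<in>{Hot, Cold}. lam * p i * (\<Sum>j=1..d i. B q j (d i) *
    (ccdf (X i) w + H F j (min j (k i)) w - (LBINT u:{0..w}. H F j (min j (k i)) u * g i (w - u)))))"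
  unfolding up_rate_def rate_def mult.assoc prob_jump_over_eq ..

end

section \<open>The boundary value\<close>

context cavity_equilibrium
begin

lemma ccdf_at_top: "(ccdf F \<longlongrightarrow> 0) at_top"
proof -
  interpret F: real_distribution F
    by (intro real_distribution.intro F_prob) (unfold_locales, simp)
  have "((\<lambda>u. 1 - cdf F u) \<longlongrightarrow> 1 - 1) at_top"
    by (intro tendsto_intros F.cdf_lim_at_top_prob)
  then show ?thesis by (simp add: ccdf_eq[abs_def] cdf_def)
qed

text \<open>The limit of \<open>prob_served_le\<close> as the workload bound tends to
  infinity.\<close>

lemma prob_served: "real (d i) * prob {\<omega> \<in> space M. served i \<omega>} = (\<Sum>j=1..d i. real (min j (k i)) * B q j (d i))"
proof -
  have "(\<lambda>n. prob {\<omega> \<in> space M. served i \<omega> \<and> U 0 \<omega> \<le> real n}) \<longlonglongrightarrow> prob (\<Union>n. {\<omega> \<in> space M. served i \<omega> \<and> U 0 \<omega> \<le> real n})"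
    by (intro finite_Lim_measure_incseq) (auto simp: incseq_def)
  also have "(\<Union>n. {\<omega> \<in> space M. served i \<omega> \<and> U 0 \<omega> \<le> real n}) = {\<omega> \<in> space M. served i \<omega>}"
    by (auto intro: real_arch_simple)
  finally have "(\<lambda>n. real (d i) * prob {\<omega> \<in> space M. served i \<omega> \<and> U 0 \<omega> \<le> real n})
      \<longlonglongrightarrow> real (d i) * prob {\<omega> \<in> space M. served i \<omega>}"
    by (intro tendsto_intros)
  moreover have "(\<lambda>n. real (d i) * prob {\<omega> \<in> space M. served i \<omega> \<and> U 0 \<omega> \<le> real n})
      \<longlonglongrightarrow> (\<Sum>j=1..d i. B q j (d i) * real (min j (k i)))"
    unfolding prob_served_le
  proof (intro tendsto_sum tendsto_mult tendsto_const)
    fix j assume j: "j \<in> {1..d i}"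
    have "(\<lambda>n. ccdf F (real n)) \<longlonglongrightarrow> 0"
      using ccdf_at_top filterlim_real_sequentially by (rule filterlim_compose)
    then have "(\<lambda>n. H F j (min j (k i)) (real n) + 1) \<longlonglongrightarrow>
        (\<Sum>m=1..j. real (min m (min j (k i))) * real (j choose m) * 0 ^ (j - m) * (1 - 0) ^ m) - 1 + 1"
      unfolding H_def by (intro tendsto_intros)
    \<comment> \<open>The powers of 0 remove every term except \<open>m = j\<close>, where
      \<open>0 ^ 0 = 1\<close>.\<close>
    also have "(\<Sum>m=1..j. real (min m (min j (k i))) * real (j choose m) * 0 ^ (j - m) * (1 - 0) ^ m)
        = (\<Sum>m=1..j. if m = j then real (min j (k i)) else 0)"
      by (intro sum.cong) auto
    also have "\<dots> = real (min j (k i))"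
      using j by simp
    finally show "(\<lambda>n. H F j (min j (k i)) (real n) + 1) \<longlonglongrightarrow> real (min j (k i))" by simp
  qed
  ultimately show ?thesis
    by (auto dest: LIMSEQ_unique simp: mult.commute)
qed

section \<open>Integrating the up-crossing rate over all levels\<close>

lemma up_rate_nonneg: "0 \<le> up_rate w"
  unfolding up_rate_def by (intro sum_nonneg mult_nonneg_nonneg rate_nonneg measure_nonneg)

text \<open>Valued in \<open>ennreal\<close>, so that the integrals over levels and outcomes can be
  exchanged without an integrability condition.\<close>

definition over :: "ftype \<Rightarrow> real \<Rightarrow> 'a \<Rightarrow> ennreal" where
  "over i x \<omega> = (if served i \<omega> \<and> U 0 \<omega> \<le> x \<and> x < U 0 \<omega> + S i 0 \<omega> then 1 else 0)"

lemma over_measurable [measurable]: "(\<lambda>(x, \<omega>). over i x \<omega>) \<in> borel_measurable (lborel \<Otimes>\<^sub>M M)"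
  unfolding over_def by measurable

lemma up_rate_over: "ennreal (up_rate x) = (\<Sum>i\<in>{Hot, Cold}. ennreal (rate i) * (\<integral>\<^sup>+ \<omega>. over i x \<omega> \<partial>M))"
proof -
  have "(\<integral>\<^sup>+ \<omega>. over i x \<omega> \<partial>M) = ennreal (prob {\<omega> \<in> space M. served i \<omega> \<and> U 0 \<omega> \<le> x \<and> x < U 0 \<omega> + S i 0 \<omega>})" for i
  proof -
    have "(\<integral>\<^sup>+ \<omega>. over i x \<omega> \<partial>M)
        = (\<integral>\<^sup>+ \<omega>. indicator {\<omega> \<in> space M. served i \<omega> \<and> U 0 \<omega> \<le> x \<and> x < U 0 \<omega> + S i 0 \<omega>} \<omega> \<partial>M)"
      by (intro nn_integral_cong) (auto simp: over_def indicator_def)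
    also have "\<dots> = emeasure M {\<omega> \<in> space M. served i \<omega> \<and> U 0 \<omega> \<le> x \<and> x < U 0 \<omega> + S i 0 \<omega>}"
      by (rule nn_integral_indicator) measurable
    finally show ?thesis by (simp add: emeasure_eq_measure)
  qed
  then show ?thesis
    using rate_nonneg by (simp add: up_rate_def ennreal_mult')
qed

lemma up_rate_measurable [measurable]: "up_rate \<in> borel_measurable borel"
proof -
  have "(\<lambda>x. ennreal (up_rate x)) \<in> borel_measurable borel"
    unfolding up_rate_over by measurable
  then have "(\<lambda>x. enn2real (ennreal (up_rate x))) \<in> borel_measurable borel" by measurable
  then show ?thesis by (simp add: up_rate_nonneg)
qed

text \<open>For a fixed served outcome the levels crossed form the interval from \<open>U 0\<close>
  to \<open>U 0 + S i 0\<close>, whose length is the service time. The expectation then factors,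
  because the service time is independent of the selection.\<close>

lemma nn_integral_over:
  "(\<integral>\<^sup>+ x. (\<integral>\<^sup>+ \<omega>. over i x \<omega> \<partial>M) * indicator {0<..} x \<partial>lborel)
    = ennreal (prob {\<omega> \<in> space M. served i \<omega>}) * (\<integral>\<^sup>+ x. ennreal x \<partial>X i)"
proof -
  interpret pair_sigma_finite lborel M ..
  have "(\<integral>\<^sup>+ x. (\<integral>\<^sup>+ \<omega>. over i x \<omega> \<partial>M) * indicator {0<..} x \<partial>lborel)
      = (\<integral>\<^sup>+ x. (\<integral>\<^sup>+ \<omega>. over i x \<omega> * indicator {0<..} x \<partial>M) \<partial>lborel)"
    by (intro nn_integral_cong nn_integral_multc[symmetric]) measurable
  also have "\<dots> = (\<integral>\<^sup>+ \<omega>. (\<integral>\<^sup>+ x. over i x \<omega> * indicator {0<..} x \<partial>lborel) \<partial>M)"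
    by (rule Fubini'[symmetric]) measurable
  also have "\<dots> = (\<integral>\<^sup>+ \<omega>. ennreal (S i 0 \<omega>) * (if served i \<omega> then 1 else 0) \<partial>M)"
  proof (rule nn_integral_cong_AE)
    show "AE \<omega> in M. (\<integral>\<^sup>+ x. over i x \<omega> * indicator {0<..} x \<partial>lborel) = ennreal (S i 0 \<omega>) * (if served i \<omega> then 1 else 0)"
      using U0_nonneg S_nonneg[of i 0]
    proof eventually_elim
      case (elim \<omega>)
      show ?case
      proof (cases "served i \<omega>")
        case True
        have "(\<integral>\<^sup>+ x. over i x \<omega> * indicator {0<..} x \<partial>lborel)
            = (\<integral>\<^sup>+ x. indicator {U 0 \<omega>..<U 0 \<omega> + S i 0 \<omega>} x \<partial>lborel)"
        proof (rule nn_integral_cong_AE)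
          \<comment> \<open>Only level 0 can be crossed and yet lie outside the positive half-line,
            and it is a null set.\<close>
          show "AE x in lborel. over i x \<omega> * indicator {0<..} x = (indicator {U 0 \<omega>..<U 0 \<omega> + S i 0 \<omega>} x :: ennreal)"
            using AE_lborel_singleton[of "0::real"]
          proof eventually_elim
            fix x :: real assume "x \<noteq> 0"
            show "over i x \<omega> * indicator {0<..} x = (indicator {U 0 \<omega>..<U 0 \<omega> + S i 0 \<omega>} x :: ennreal)"
            proof (cases "U 0 \<omega> \<le> x \<and> x < U 0 \<omega> + S i 0 \<omega>")
              case True
              then have "0 < x" using elim(1) \<open>x \<noteq> 0\<close> by linarith
              then show ?thesis using True \<open>served i \<omega>\<close> by (simp add: over_def)
            qed (auto simp: over_def)
          qed
        qed
        also have "\<dots> = ennreal (S i 0 \<omega>)"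
          using elim by simp
        finally show ?thesis using True by simp
      qed (simp add: over_def)
    qed
  qed
  also have "\<dots> = (\<integral>\<^sup>+ \<omega>. ennreal (S i 0 \<omega>) \<partial>M) * (\<integral>\<^sup>+ \<omega>. (if served i \<omega> then 1 else 0) \<partial>M)"
  proof -
    \<comment> \<open>The product rule for expectations is applied to a finite family, here one
      indexed by the booleans.\<close>
    define T where "T = (\<lambda>b. if b then (\<lambda>\<omega>. ennreal (S i 0 \<omega>)) else (\<lambda>\<omega>. if served i \<omega> then 1 else 0))"
    have "Service i 0 \<in> inputs d" by (auto simp: inputs_def)
    have "indep_var borel (T True) borel (T False)"
    proof (rule generated_indep_var[OF val_indep[OF order_refl], of "{Service i 0}" "emb i ` selection i"])
      show "{Service i 0} \<inter> emb i ` selection i = {}"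
        by (auto simp: emb_def split: if_splits)
      have [measurable]: "S i 0 \<in> borel_measurable (generated (val 0) {Service i 0})"
        using measurable_generated[of "Service i 0" "{Service i 0}" "val 0"] by (simp add: val_def[abs_def])
      show "T True \<in> borel_measurable (generated (val 0) {Service i 0})"
        unfolding T_def by simp
      note served_measurable[OF order_refl, measurable]
      show "T False \<in> borel_measurable (generated (val 0) (emb i ` selection i))"
        unfolding T_def by simp
    qed (use \<open>Service i 0 \<in> inputs d\<close> emb_inputs in auto)
    moreover have "case_bool borel borel = (\<lambda>_. borel :: ennreal measure)" "case_bool (T True) (T False) = T"
      by (auto simp: fun_eq_iff split: bool.splits)
    ultimately have "indep_vars (\<lambda>_. borel) T UNIV"
      by (simp add: indep_var_def)
    from indep_vars_nn_integral[OF finite this] show ?thesis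
      by (simp add: UNIV_bool T_def mult.commute)
  qed
  also have "(\<integral>\<^sup>+ \<omega>. (if served i \<omega> then 1 else 0) \<partial>M) = (\<integral>\<^sup>+ \<omega>. indicator {\<omega> \<in> space M. served i \<omega>} \<omega> \<partial>M)"
    by (intro nn_integral_cong) (auto simp: indicator_def)
  also have "\<dots> = ennreal (prob {\<omega> \<in> space M. served i \<omega>})"
    by (subst nn_integral_indicator) (auto simp: emeasure_eq_measure)
  also have "(\<integral>\<^sup>+ \<omega>. ennreal (S i 0 \<omega>) \<partial>M) = (\<integral>\<^sup>+ x. ennreal x \<partial>X i)"
    unfolding S_distr[of i 0, symmetric] by (subst nn_integral_distr) auto
  finally show ?thesis by (simp add: mult.commute)
qed

text \<open>The derivative is known only at positive levels, so the fundamental theorem is applied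
  on \<open>[1 / (n + 1), \<infinity>)\<close>. Monotone convergence and right-continuity at 0 give
  the limit.\<close>

lemma nn_integral_up_rate: "(\<integral>\<^sup>+ x. ennreal (up_rate x) * indicator {0<..} x \<partial>lborel) = ennreal (ccdf F 0)"
proof -
  let ?a = "\<lambda>n. 1 / real (Suc n)"
  have "(\<integral>\<^sup>+ x. ennreal (up_rate x) * indicator {?a n..} x \<partial>lborel) = ennreal (ccdf F (?a n))" for n
  proof -
    have "(\<integral>\<^sup>+ x. ennreal (up_rate x) * indicator {?a n..} x \<partial>lborel) = ennreal (0 - (- ccdf F (?a n)))"
    proof (rule nn_integral_FTC_atLeast)
      fix x assume "?a n \<le> x"
      moreover have "0 < ?a n" by simp
      ultimately have "0 < x" by linarith
      then show "((\<lambda>x. - ccdf F x) has_real_derivative up_rate x) (at x)"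
        using DERIV_minus[OF ccdf_derivative] by simp
      show "0 \<le> up_rate x" by (rule up_rate_nonneg)
    next
      show "((\<lambda>x. - ccdf F x) \<longlongrightarrow> 0) at_top"
        using tendsto_minus[OF ccdf_at_top] by simp
    qed simp
    then show ?thesis by simp
  qed
  moreover have "(\<lambda>n. \<integral>\<^sup>+ x. ennreal (up_rate x) * indicator {?a n..} x \<partial>lborel)
      \<longlonglongrightarrow> (\<integral>\<^sup>+ x. ennreal (up_rate x) * indicator {0<..} x \<partial>lborel)"
  proof (rule nn_integral_LIMSEQ)
    have "?a (Suc n) \<le> ?a n" for n by (simp add: frac_le)
    then have "?a n \<le> x \<Longrightarrow> ?a (Suc n) \<le> x" for n x by (rule order_trans)
    then show "incseq (\<lambda>n x. ennreal (up_rate x) * indicator {?a n..} x)"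
      by (intro incseq_SucI le_funI mult_left_mono) (auto simp: indicator_def simp del: of_nat_Suc)
    fix x
    show "(\<lambda>n. ennreal (up_rate x) * indicator {?a n..} x) \<longlonglongrightarrow> ennreal (up_rate x) * indicator {0<..} x"
    proof (cases "0 < x")
      case True
      then obtain n0 where n0: "?a n0 < x"
        using nat_approx_posE by blast
      have "?a n \<le> x" if "n0 \<le> n" for n
      proof -
        have "?a n \<le> ?a n0" using that by (simp add: frac_le)
        then show ?thesis using n0 by simp
      qed
      then have "\<forall>\<^sub>F n in sequentially. ennreal (up_rate x) * indicator {?a n..} x = ennreal (up_rate x) * indicator {0<..} x"
        using True by (auto simp: eventually_sequentially indicator_def intro!: exI[of _ n0])
      then show ?thesis by (rule tendsto_eventually)
    next
      case False
      then have "\<not> ?a n \<le> x" for n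
        using divide_pos_pos[of 1 "real (Suc n)"] by linarith
      then show ?thesis using False by (simp add: indicator_def)
    qed
  qed measurable
  moreover have "(\<lambda>n. ennreal (ccdf F (?a n))) \<longlonglongrightarrow> ennreal (ccdf F 0)"
  proof (rule tendsto_ennrealI)
    have "filterlim ?a (at_right 0) sequentially"
      unfolding filterlim_at using LIMSEQ_inverse_real_of_nat by (auto simp: inverse_eq_divide)
    from filterlim_compose[OF ccdf_right_continuous[of 0] this]
    show "(\<lambda>n. ccdf F (?a n)) \<longlonglongrightarrow> ccdf F 0" by simp
  qed
  ultimately show ?thesis
    by (simp add: LIMSEQ_unique)
qed

text \<open>Also correct for a diverging mean, where both sides take the default value 0.\<close>

lemma mean_nn: "(\<integral>x. x \<partial>X i) = enn2real (\<integral>\<^sup>+ x. ennreal x \<partial>X i)"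
proof (rule integral_eq_nn_integral)
  show "AE x in X i. 0 \<le> x"
    using S_nonneg[of i 0] unfolding S_distr[of i 0, symmetric] by (simp add: AE_distr_iff)
qed simp

text \<open>Should a mean service time diverge, so that its Bochner integral is the junk value 0, then the
  corresponding rate vanishes, because the left-hand side is finite.\<close>

lemma ccdf_0: "ccdf F 0 = (\<Sum>i\<in>{Hot, Cold}. lam * p i * (\<integral>x. x \<partial>X i) * (\<Sum>j=1..d i. real (min j (k i)) * B q j (d i)))"
proof -
  let ?t = "\<lambda>i. ennreal (rate i) * (ennreal (prob {\<omega> \<in> space M. served i \<omega>}) * (\<integral>\<^sup>+ x. ennreal x \<partial>X i))"
  have "ennreal (ccdf F 0) = (\<integral>\<^sup>+ x. (\<Sum>i\<in>{Hot, Cold}. ennreal (rate i) * ((\<integral>\<^sup>+ \<omega>. over i x \<omega> \<partial>M) * indicator {0<..} x)) \<partial>lborel)"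
    unfolding nn_integral_up_rate[symmetric] up_rate_over sum_distrib_right mult.assoc ..
  also have "\<dots> = (\<Sum>i\<in>{Hot, Cold}. \<integral>\<^sup>+ x. ennreal (rate i) * ((\<integral>\<^sup>+ \<omega>. over i x \<omega> \<partial>M) * indicator {0<..} x) \<partial>lborel)"
    by (rule nn_integral_sum) measurable
  also have "\<dots> = (\<Sum>i\<in>{Hot, Cold}. ennreal (rate i) * (\<integral>\<^sup>+ x. (\<integral>\<^sup>+ \<omega>. over i x \<omega> \<partial>M) * indicator {0<..} x \<partial>lborel))"
    by (intro sum.cong refl nn_integral_cmult) measurable
  finally have eq: "ennreal (ccdf F 0) = ?t Hot + ?t Cold"
    by (simp add: nn_integral_over)
  \<comment> \<open>Finiteness of both summands is what makes \<open>enn2real\<close> additive on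
    them.\<close>
  have "?t Hot + ?t Cold < \<top>"
    unfolding eq[symmetric] by simp
  then have "enn2real (?t Hot + ?t Cold) = enn2real (?t Hot) + enn2real (?t Cold)"
    unfolding ennreal_add_less_top by (elim conjE) (rule enn2real_plus)
  then have "ccdf F 0 = enn2real (?t Hot) + enn2real (?t Cold)"
    unfolding eq[symmetric] by (simp only: enn2real_ennreal[OF ccdf_bounds(1)])
  moreover have "enn2real (?t i) = lam * p i * (\<integral>x. x \<partial>X i) * (\<Sum>j=1..d i. real (min j (k i)) * B q j (d i))" for i
    using rate_nonneg[of i] unfolding prob_served[symmetric] mean_nn enn2real_mult
    by (simp add: rate_def)
  ultimately show ?thesis by simp
qed

end

section \<open>Phase-type service times in the equilibrium equation\<close>

lemma service_density_measurable [measurable]: "service_density \<delta> \<alpha> A \<in> borel_measurable borel"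
  unfolding service_density_def[abs_def] by measurable

lemma service_density_nonneg: "phase_type \<alpha> A \<Longrightarrow> 0 \<le> service_density \<delta> \<alpha> A x"
  by (simp add: service_density_def ph_density_nonneg)

lemma service_density_neg: "0 \<le> \<delta> \<Longrightarrow> x < 0 \<Longrightarrow> service_density \<delta> \<alpha> A x = 0"
  by (simp add: service_density_def ph_density_def)

lemma sum_B: "(\<Sum>j=1..d. B q j d) = 1 - B q 0 d"
proof -
  have "(\<Sum>j\<le>d. B q j d) = (q + (1 - q)) ^ d"
    unfolding B_def by (rule binomial_ring[symmetric])
  then show ?thesis
    by (simp add: sum.atLeast1_atMost_eq sum.atMost_shift lessThan_Suc_atMost atLeast0AtMost)
qed

theorem proposition1:
  fixes lam q :: real
    and p \<delta> :: "ftype \<Rightarrow> real"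
    and d k :: "ftype \<Rightarrow> nat"
    and \<alpha>h :: "real^'m" and Ah :: "real^'m^'m"
    and \<alpha>c :: "real^'n" and Ac :: "real^'n^'n"
    and X :: "ftype \<Rightarrow> real measure"
    and g :: "ftype \<Rightarrow> real \<Rightarrow> real"
    and M :: "'a measure"
    and F :: "real measure"
  assumes "0 < lam" and "0 < q" and "q \<le> 1"
    and "\<forall>i. 0 \<le> p i" and "p Hot + p Cold = 1"
    and "\<forall>i. 1 \<le> k i \<and> k i \<le> d i" and "k Hot = 1"
    and "\<forall>i. 0 \<le> \<delta> i"
    and "phase_type \<alpha>h Ah" and "phase_type \<alpha>c Ac"
    and "X Hot = service_law (\<delta> Hot) \<alpha>h Ah" and "X Cold = service_law (\<delta> Cold) \<alpha>c Ac"
    and "g Hot = service_density (\<delta> Hot) \<alpha>h Ah" and "g Cold = service_density (\<delta> Cold) \<alpha>c Ac"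
    and "equilibrium_workload M lam p d k q X F"
  shows "(\<forall>w>0. (ccdf F has_real_derivative
            - (\<Sum>i\<in>{Hot, Cold}. lam * p i *
                (\<Sum>j=1..d i. B q j (d i) *
                  (ccdf (X i) w + H F j (min j (k i)) w
                    - (LBINT u:{0..w}. H F j (min j (k i)) u * g i (w - u)))))) (at w))
       \<and> ccdf F 0 =
           lam * p Hot * (\<integral>x. x \<partial>X Hot) * (1 - B q 0 (d Hot))
           + lam * p Cold * (\<integral>x. real (k Cold) * x \<partial>X Cold)
               * (\<Sum>m=1..d Cold. real (min m (k Cold)) / real (k Cold) * B q m (d Cold))
       \<and> (\<integral>x. real (k Cold) * x \<partial>X Cold) = real (k Cold) * (\<integral>x. x \<partial>X Cold)"
proof -
  obtain N Av W V S U where queue: "cavity_queue M lam p d k q X F N Av W V S U"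
    and stationary: "\<forall>t\<ge>0. distr M borel (U t) = F" and "workload_law F"
    using assms(15) by (auto simp: equilibrium_workload_def)
  \<comment> \<open>The two types are treated separately, since their phase spaces may have
    different dimensions and hence different types.\<close>
  have g: "g i \<in> borel_measurable borel" "0 \<le> g i x" "x < 0 \<Longrightarrow> g i x = 0"
      "X i = density lborel (\<lambda>x. ennreal (g i x))" for i x
  proof -
    have "g i \<in> borel_measurable borel \<and> (\<forall>x. 0 \<le> g i x) \<and> (\<forall>x<0. g i x = 0)
        \<and> X i = density lborel (\<lambda>x. ennreal (g i x))"
    proof (cases i)
      case Hot
      show ?thesis
        unfolding Hot assms(11) assms(13) service_law_density
        by (intro conjI allI impI service_density_measurable service_density_nonneg[OF assms(9)]
            service_density_neg refl) (use assms(8) in auto)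
    next
      case Cold
      show ?thesis
        unfolding Cold assms(12) assms(14) service_law_density
        by (intro conjI allI impI service_density_measurable service_density_nonneg[OF assms(10)]
            service_density_neg refl) (use assms(8) in auto)
    qed
    then show "g i \<in> borel_measurable borel" "0 \<le> g i x" "x < 0 \<Longrightarrow> g i x = 0"
      "X i = density lborel (\<lambda>x. ennreal (g i x))" by blast+
  qed
  interpret cavity_equilibrium M lam q p d k X g F N Av W V S U
  proof (rule cavity_equilibrium.intro)
    show "prob_space M" using queue by (simp add: cavity_queue_def)
    show "cavity_equilibrium_axioms M lam q p d k X g F N Av W V S U"
      by (rule cavity_equilibrium_axioms.intro) (use assms(1-6) g queue stationary \<open>workload_law F\<close> in auto)
  qed
  have k: "0 < real (k Cold)" using assms(6) by (simp add: Suc_le_eq)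
  \<comment> \<open>For \<open>k Hot = 1\<close> every weight with \<open>j \<ge> 1\<close> is 1,
    and what remains is the probability that some selected server is available.\<close>
  have "(\<Sum>j=1..d Hot. real (min j (k Hot)) * B q j (d Hot)) = 1 - B q 0 (d Hot)"
    using assms(7) sum_B[of q "d Hot"] by simp
  \<comment> \<open>The divisor \<open>k Cold\<close> cancels against the one in the mean file
    service time.\<close>
  moreover have "(\<Sum>m=1..d Cold. real (min m (k Cold)) / real (k Cold) * B q m (d Cold))
      = (\<Sum>m=1..d Cold. real (min m (k Cold)) * B q m (d Cold)) / real (k Cold)"
    by (simp add: sum_divide_distrib)
  ultimately have "ccdf F 0 =
           lam * p Hot * (\<integral>x. x \<partial>X Hot) * (1 - B q 0 (d Hot))
           + lam * p Cold * (\<integral>x. real (k Cold) * x \<partial>X Cold)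
               * (\<Sum>m=1..d Cold. real (min m (k Cold)) / real (k Cold) * B q m (d Cold))"
    using ccdf_0 k by simp
  then show ?thesis
    using ccdf_derivative unfolding up_rate_eq by simp
qed

end
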